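(* Let $x_0,x_1\in\mathbb{R}^n$, $r_0>0$ and $r_1\ge0$. The LDDMM-Fisher-Rao distance between the two Dirac measures ($0$-varifolds) $r_0\delta_{x_0}$ and $r_1\delta_{x_1}$ satisfies $$d_{V-\mathcal{FR}}(r_0\delta_{x_0},r_1\delta_{x_1})^2=\frac12 d_{K_V}(x_0,x_1)^2+2\gamma(\sqrt{r_1}-\sqrt{r_0})^2,$$ where $d_{K_V}$ is the distance associated to the Riemannian metric on $\mathbb{R}^n$ given by $G_x(h,h)=h^TK_V(x,x)^{-1}h$. The geodesic is $r(t)\delta_{x(t)}$, $t\in[0,1]$, with $x(t)$ being the geodesic between $x_0$ and $x_1$ for the metric $G$ and $r(t)=\left((1-t)\sqrt{r_0}+t\sqrt{r_1}\right)^2$.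
   Context: Let $n\ge2$. A $0$-varifold is a nonnegative finite Radon measure on $\mathbb{R}^n$, and diffeomorphisms $\varphi$ act on it by the usual pushforward of measures, $\varphi_\#(r\delta_x)=r\delta_{\varphi(x)}$. $V$ is a Hilbert space of vector fields $\mathbb{R}^n\to\mathbb{R}^n$ continuously embedded in $C_0^2(\mathbb{R}^n,\mathbb{R}^n)$ ($C^2$ vector fields vanishing at infinity together with their first and second order derivatives); it is a reproducing kernel Hilbert space with matrix-valued positive kernel $K_V:\mathbb{R}^n\times\mathbb{R}^n\to\mathbb{R}^{n\times n}$, with $K_V(x,x)$ invertible for every $x$. For $v\in L^2([0,1],V)$, $\varphi_t^v$ is the flow: $\varphi_0^v=\mathrm{Id}$, $\partial_t\varphi_t^v=v_t\circ\varphi_t^v$. Fix $\gamma>0$. For a source varifold $\mu_0=r_0\delta_{x_0}$, a weight control is a function in $L^2([0,1],L^2(|\mu_0|))$, that is, a function $\eta\in L^2([0,1],\mathbb{R})$; set $\tilde\alpha_t=1+\frac12\int_0^t\eta_s\,ds$. The pair $(v,\eta)$ produces the path of varifolds $\mu_t=\tilde\alpha_t^2\,(\varphi_t^v)_\#(r_0\delta_{x_0})=\tilde\alpha_t^2\,r_0\,\delta_{\varphi_t^v(x_0)}$. The squared LDDMM-Fisher-Rao distance $d_{V-\mathcal{FR}}(r_0\delta_{x_0},r_1\delta_{x_1})^2$ is the infimum of $$\frac12\int_0^1\|v_t\|_V^2\,dt+\frac\gamma2\int_0^1\eta_t^2\,r_0\,dt$$ over $(v,\eta)\in L^2([0,1],V\times\mathbb{R})$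 such that $\tilde\alpha_t\ge0$ for all $t\in[0,1]$ and the transformed varifold at time $1$ equals the target, i.e. $\tilde\alpha_1^2\,(\varphi_1^v)_\#(r_0\delta_{x_0})=r_1\delta_{x_1}$ as measures. A geodesic is a path $t\mapsto\mu_t$ associated to a minimizer $(v,\eta)$. "Geodesic for the metric $G$" means minimizing geodesic parametrized with constant speed.
   Formalization: When r_1=0, x_1=x_0 is additionally assumed: for r_1=0 and x_1≠x_0 the target is the zero measure, so v=0, η=-2 is admissible with cost 2γr_0, strictly below the claimed value since d_{K_V}(x_0,x_1)>0; the formula fails in all these cases. *)

theory Defs
  imports "HOL-Analysis.Analysis" "HOL-Probability.Giry_Monad"
begin

subsection \<open>The space of vector fields and its kernel\<close>

definition frechet_D :: "('a::real_normed_vector \<Rightarrow> 'b::real_normed_vector) \<Rightarrow> 'a \<Rightarrow> 'a \<Rightarrow>\<^sub>L 'b" where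
  "frechet_D f x = Blinfun (frechet_derivative f (at x))"

definition C2_vanishing :: "(real^'n \<Rightarrow> real^'n) \<Rightarrow> bool" where
  "C2_vanishing f \<longleftrightarrow>
     (\<forall>x. f differentiable (at x)) \<and> (\<forall>x. frechet_D f differentiable (at x)) \<and>
     continuous_on UNIV (frechet_D (frechet_D f)) \<and>
     (f \<longlongrightarrow> 0) at_infinity \<and> (frechet_D f \<longlongrightarrow> 0) at_infinity \<and> (frechet_D (frechet_D f) \<longlongrightarrow> 0) at_infinity"

definition C2_norm :: "(real^'n \<Rightarrow> real^'n) \<Rightarrow> real" where
  "C2_norm f = (SUP x. norm (f x)) + (SUP x. norm (frechet_D f x)) + (SUP x. norm (frechet_D (frechet_D f) x))"

text \<open>The Hilbert space of vector fields is a complete inner product space \<open>'v\<close> together with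
  the map \<open>ev\<close> that sends an element to the vector field it is.\<close>

definition C2_embedded :: "('v::{real_inner,complete_space} \<Rightarrow> real^'n \<Rightarrow> real^'n) \<Rightarrow> bool" where
  "C2_embedded ev \<longleftrightarrow>
     inj ev \<and>
     (\<forall>u v x. ev (u + v) x = ev u x + ev v x) \<and> (\<forall>c v x. ev (c *\<^sub>R v) x = c *\<^sub>R ev v x) \<and>
     (\<forall>v. C2_vanishing (ev v)) \<and> (\<exists>C. \<forall>v. C2_norm (ev v) \<le> C * norm v)"

text \<open>This determines \<open>K\<close> uniquely; positivity of \<open>K\<close> is a consequence.\<close>

definition reproducing_kernel ::
    "('v::{real_inner,complete_space} \<Rightarrow> real^'n \<Rightarrow> real^'n)
      \<Rightarrow> (real^'n \<Rightarrow> real^'n \<Rightarrow> real^'n^'n) \<Rightarrow> bool" where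
  "reproducing_kernel ev K \<longleftrightarrow>
     (\<forall>x a. \<exists>k. ev k = (\<lambda>y. K y x *v a) \<and> (\<forall>v. inner k v = inner a (ev v x)))"


subsection \<open>Riemannian metrics on Euclidean space\<close>

definition C1_path :: "(real \<Rightarrow> real^'n) \<Rightarrow> bool" where
  "C1_path g \<longleftrightarrow>
     (\<forall>t\<in>{0..1}. g differentiable (at t within {0..1})) \<and>
     continuous_on {0..1} (\<lambda>t. vector_derivative g (at t within {0..1}))"

definition speed :: "(real^'n \<Rightarrow> real^'n \<Rightarrow> real^'n \<Rightarrow> real) \<Rightarrow> (real \<Rightarrow> real^'n) \<Rightarrow> real \<Rightarrow> real" where
  "speed G g t = (let h = vector_derivative g (at t within {0..1}) in sqrt (G (g t) h h))"

definition curve_length :: "(real^'n \<Rightarrow> real^'n \<Rightarrow> real^'n \<Rightarrow> real) \<Rightarrow> (real \<Rightarrow> real^'n) \<Rightarrow> real" where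
  "curve_length G g = integral {0..1} (speed G g)"

definition riemannian_dist ::
    "(real^'n \<Rightarrow> real^'n \<Rightarrow> real^'n \<Rightarrow> real) \<Rightarrow> real^'n \<Rightarrow> real^'n \<Rightarrow> real" where
  "riemannian_dist G x y = (INF g \<in> {g. C1_path g \<and> g 0 = x \<and> g 1 = y}. curve_length G g)"

definition minimizing_geodesic ::
    "(real^'n \<Rightarrow> real^'n \<Rightarrow> real^'n \<Rightarrow> real) \<Rightarrow> real^'n \<Rightarrow> real^'n \<Rightarrow> (real \<Rightarrow> real^'n) \<Rightarrow> bool" where
  "minimizing_geodesic G x y g \<longleftrightarrow>
     C1_path g \<and> g 0 = x \<and> g 1 = y \<and> curve_length G g = riemannian_dist G x y \<and>
     (\<exists>c. \<forall>t\<in>{0..1}. speed G g t = c)"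

definition kernel_metric ::
    "(real^'n \<Rightarrow> real^'n \<Rightarrow> real^'n^'n) \<Rightarrow> real^'n \<Rightarrow> real^'n \<Rightarrow> real^'n \<Rightarrow> real" where
  "kernel_metric K x h k = inner h (matrix_inv (K x x) *v k)"


subsection \<open>The LDDMM-Fisher-Rao distance from a Dirac measure\<close>

text \<open>For \<open>r = 0\<close> this is the zero measure, whatever \<open>x\<close> is.\<close>

definition dirac :: "real \<Rightarrow> real^'n \<Rightarrow> (real^'n) measure" where
  "dirac r x = scale_measure (ennreal r) (return borel x)"

text \<open>No separability of the codomain is required here: a space satisfying \<open>C2_embedded\<close> that has
  a reproducing kernel is separable, so that Borel and strong measurability agree.\<close>

definition L2_unit :: "(real \<Rightarrow> 'v::real_normed_vector) \<Rightarrow> bool" where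
  "L2_unit f \<longleftrightarrow> f \<in> borel_measurable (lebesgue_on {0..1}) \<and>
     integrable (lebesgue_on {0..1}) (\<lambda>t. (norm (f t))\<^sup>2)"

text \<open>For \<open>v\<close> in \<open>L\<^sup>2\<close> the flow equation is understood in integrated form.\<close>

definition is_flow ::
    "('v \<Rightarrow> real^'n \<Rightarrow> real^'n) \<Rightarrow> (real \<Rightarrow> 'v) \<Rightarrow> (real \<Rightarrow> real^'n \<Rightarrow> real^'n) \<Rightarrow> bool" where
  "is_flow ev v \<phi> \<longleftrightarrow>
     (\<forall>x. \<forall>t\<in>{0..1}. ((\<lambda>s. ev (v s) (\<phi> s x)) has_integral (\<phi> t x - x)) {0..t})"

definition weight :: "(real \<Rightarrow> real) \<Rightarrow> real \<Rightarrow> real" where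
  "weight \<eta> t = 1 + 1/2 * integral {0..t} \<eta>"

definition transported ::
    "real \<Rightarrow> real^'n \<Rightarrow> (real \<Rightarrow> real) \<Rightarrow> (real \<Rightarrow> real^'n \<Rightarrow> real^'n) \<Rightarrow> real \<Rightarrow> (real^'n) measure" where
  "transported r0 x0 \<eta> \<phi> t =
     scale_measure (ennreal ((weight \<eta> t)\<^sup>2)) (distr (dirac r0 x0) borel (\<phi> t))"

definition admissible ::
    "('v::{real_inner,complete_space} \<Rightarrow> real^'n \<Rightarrow> real^'n) \<Rightarrow> real \<Rightarrow> real^'n \<Rightarrow> (real^'n) measure
      \<Rightarrow> ((real \<Rightarrow> 'v) \<times> (real \<Rightarrow> real)) set" where
  "admissible ev r0 x0 \<nu> =
     {(v, \<eta>). L2_unit v \<and> L2_unit \<eta> \<and> (\<forall>t\<in>{0..1}. weight \<eta> t \<ge> 0) \<and>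
        (\<exists>\<phi>. is_flow ev v \<phi> \<and> transported r0 x0 \<eta> \<phi> 1 = \<nu>)}"

definition cost :: "real \<Rightarrow> real \<Rightarrow> (real \<Rightarrow> 'v::real_inner) \<times> (real \<Rightarrow> real) \<Rightarrow> real" where
  "cost \<gamma> r0 = (\<lambda>(v, \<eta>).
     1/2 * (LINT t|lebesgue_on {0..1}. (norm (v t))\<^sup>2) +
     \<gamma>/2 * (LINT t|lebesgue_on {0..1}. (\<eta> t)\<^sup>2 * r0))"

text \<open>Extended real, so that the infimum over an empty admissible set would be \<open>\<infinity>\<close>.\<close>

definition lddmm_fr_dist_sq ::
    "('v::{real_inner,complete_space} \<Rightarrow> real^'n \<Rightarrow> real^'n) \<Rightarrow> real \<Rightarrow> real \<Rightarrow> real^'n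
      \<Rightarrow> (real^'n) measure \<Rightarrow> ereal" where
  "lddmm_fr_dist_sq ev \<gamma> r0 x0 \<nu> = (INF c \<in> admissible ev r0 x0 \<nu>. ereal (cost \<gamma> r0 c))"

definition lddmm_fr_geodesic ::
    "('v::{real_inner,complete_space} \<Rightarrow> real^'n \<Rightarrow> real^'n) \<Rightarrow> real \<Rightarrow> real \<Rightarrow> real^'n
      \<Rightarrow> (real^'n) measure \<Rightarrow> (real \<Rightarrow> (real^'n) measure) \<Rightarrow> bool" where
  "lddmm_fr_geodesic ev \<gamma> r0 x0 \<nu> \<mu> \<longleftrightarrow>
     (\<exists>v \<eta> \<phi>. (v, \<eta>) \<in> admissible ev r0 x0 \<nu> \<and>
        ereal (cost \<gamma> r0 (v, \<eta>)) = lddmm_fr_dist_sq ev \<gamma> r0 x0 \<nu> \<and>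
        is_flow ev v \<phi> \<and> (\<forall>t\<in>{0..1}. \<mu> t = transported r0 x0 \<eta> \<phi> t))"

end

theory Submission
  imports Defs "HOL-Complex_Analysis.Great_Picard"
begin

text \<open>
  The cost splits into a transport part and a weight part. For a Dirac source the weight part only
  prescribes the integral of \<open>\<eta>\<close>, so the Cauchy--Schwarz inequality gives its minimum, attained exactly
  for constant \<open>\<eta>\<close>.

  For the transport part, write \<open>k x a\<close> for the representer of \<open>v \<mapsto> \<langle>a, v x\<rangle>\<close> and \<open>lift x h\<close> for the
  element of least norm whose field takes the value \<open>h\<close> at \<open>x\<close>; its norm is \<open>sqrt (G x h h)\<close>. The
  \<open>C\<^sup>2\<close> embedding makes \<open>k\<close> Lipschitz in \<open>x\<close>. Call a path of unit speed if its increments satisfy a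
  second-order dual inequality (\<open>upath\<close>). This condition contains no derivative or integral, is stable
  under concatenation and uniform limits, and holds for the arc length reparametrization of every
  trajectory of a control \<open>v\<close>, with duration the integral of \<open>norm v\<close>. Hence by Arzela--Ascoli there is
  a path of least duration \<open>D\<close>. Comparing it with short segments, its increments have almost
  additive norms, and the parallelogram law bounds its second differences by \<open>h powr (3/2)\<close>, which makes it
  \<open>C\<^sup>1\<close> with unit speed. So \<open>D\<close> is the Riemannian distance, least duration paths are the minimizing
  geodesics, and trajectories with \<open>norm v\<close> constantly \<open>D\<close> are such paths. Conversely a geodesic
  \<open>g\<close> is driven by the continuous control \<open>lift g g'\<close>, whose flow exists by Picard iteration.
\<close>

subsection \<open>Kernels and horizontal lifts\<close>

text \<open>Every dual norm estimate below pairs a vector with itself and gets an inequality of this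
  shape; the lemma cancels one factor without a case split on zero.\<close>

lemma square_le_mult_imp_le:
  fixes x c :: real
  assumes "x\<^sup>2 \<le> c * x" and "0 \<le> c" shows "x \<le> c"
  using assms by (cases "x \<le> 0") (auto simp: power2_eq_square mult_le_cancel_right)

text \<open>The suprema in \<open>C2_norm\<close> are conditionally complete, so they bound anything
  only once the range is known to be bounded: outside a ball by decay, inside it by
  compactness.\<close>

lemma vanishing_bdd_above:
  fixes f :: "real^'n \<Rightarrow> 'b::real_normed_vector"
  assumes "continuous_on UNIV f" and "(f \<longlongrightarrow> 0) at_infinity"
  shows "bdd_above (range (\<lambda>x. norm (f x)))"
proof -
  have "eventually (\<lambda>x. dist (f x) 0 < 1) at_infinity"
    using assms(2) by (rule tendstoD) simp
  then obtain b where b: "\<And>x. b \<le> norm x \<Longrightarrow> norm (f x) < 1"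
    by (auto simp: eventually_at_infinity)
  have "compact ((\<lambda>x. norm (f x)) ` cball 0 b)"
    by (intro compact_continuous_image continuous_on_norm continuous_on_subset[OF assms(1)]) auto
  then have "bdd_above ((\<lambda>x. norm (f x)) ` cball 0 b)"
    by (intro bounded_imp_bdd_above compact_imp_bounded)
  then obtain B where B: "\<And>x. norm x \<le> b \<Longrightarrow> norm (f x) \<le> B"
    unfolding bdd_above_def by (metis image_eqI mem_cball_0)
  show ?thesis
  proof (rule bdd_aboveI)
    fix y assume "y \<in> range (\<lambda>x. norm (f x))"
    then obtain x where "y = norm (f x)" by auto
    then show "y \<le> max B 1" using b[of x] B[of x] by (cases "norm x \<le> b") auto
  qed
qed

lemma C2_vanishing_bounds:
  fixes f :: "real^'n \<Rightarrow> real^'n"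
  assumes "C2_vanishing f"
  shows "norm (f x) \<le> C2_norm f" and "norm (f x - f y) \<le> C2_norm f * norm (x - y)"
proof -
  have d: "\<And>x. f differentiable (at x)" and d2: "\<And>x. frechet_D f differentiable (at x)"
    and c: "continuous_on UNIV (frechet_D (frechet_D f))"
    and l: "(f \<longlongrightarrow> 0) at_infinity" "(frechet_D f \<longlongrightarrow> 0) at_infinity"
      "(frechet_D (frechet_D f) \<longlongrightarrow> 0) at_infinity"
    using assms unfolding C2_vanishing_def by auto
  have b0: "bdd_above (range (\<lambda>x. norm (f x)))"
    using d l by (intro vanishing_bdd_above) (auto intro!: continuous_at_imp_continuous_on differentiable_imp_continuous_within)
  have b1: "bdd_above (range (\<lambda>x. norm (frechet_D f x)))"
    using d2 l by (intro vanishing_bdd_above) (auto intro!: continuous_at_imp_continuous_on differentiable_imp_continuous_within)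
  have b2: "bdd_above (range (\<lambda>x. norm (frechet_D (frechet_D f) x)))"
    using c l by (intro vanishing_bdd_above)
  have s: "norm (f x) \<le> (SUP x. norm (f x))" "norm (frechet_D f x) \<le> (SUP x. norm (frechet_D f x))"
    "norm (frechet_D (frechet_D f) x) \<le> (SUP x. norm (frechet_D (frechet_D f) x))" for x
    using b0 b1 b2 by (auto intro: cSUP_upper2)
  \<comment> \<open>Nonnegativity of all three suprema allows each one to be dominated by their
    sum.\<close>
  have p: "0 \<le> (SUP x. norm (f x))" "0 \<le> (SUP x. norm (frechet_D f x))"
    "0 \<le> (SUP x. norm (frechet_D (frechet_D f) x))"
    using s by (meson norm_ge_zero order_trans)+
  show "norm (f x) \<le> C2_norm f" using s(1)[of x] p unfolding C2_norm_def by linarith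
  have D: "norm (frechet_D f x) \<le> C2_norm f" for x using s(2)[of x] p unfolding C2_norm_def by linarith
  \<comment> \<open>\<open>Blinfun\<close> returns the intended map only for bounded linear
    arguments, which a Frechet derivative is.\<close>
  have der: "(f has_derivative frechet_D f x) (at x)" for x
  proof -
    have h: "(f has_derivative frechet_derivative f (at x)) (at x)"
      using d frechet_derivative_works by blast
    then have "blinfun_apply (Blinfun (frechet_derivative f (at x))) = frechet_derivative f (at x)"
      by (intro bounded_linear_Blinfun_apply has_derivative_bounded_linear)
    then show ?thesis using h by (simp add: frechet_D_def)
  qed
  show "norm (f x - f y) \<le> C2_norm f * norm (x - y)"
    by (rule differentiable_bound[where S=UNIV and f'="\<lambda>x. frechet_D f x"])
       (use der D in \<open>auto simp: norm_blinfun.rep_eq[symmetric]\<close>)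
qed

text \<open>One constant \<open>C\<close> serves for the sup bound and the Lipschitz bound of the
  fields. It is kept strictly positive so that it can be divided by. The representer is a function
  \<open>k\<close>, fixed once by choice.\<close>

locale rkhs_fields =
  fixes ev :: "'v::{real_inner,complete_space} \<Rightarrow> real^'n \<Rightarrow> real^'n"
    and K :: "real^'n \<Rightarrow> real^'n \<Rightarrow> real^'n^'n"
    and k :: "real^'n \<Rightarrow> real^'n \<Rightarrow> 'v" and C :: real
  assumes C_pos: "C > 0"
    and ev_bound: "norm (ev v x) \<le> C * norm v"
    and ev_lip: "norm (ev v x - ev v y) \<le> C * norm v * norm (x - y)"
    and ev_add: "ev (u + v) x = ev u x + ev v x"
    and ev_scale: "ev (c *\<^sub>R v) x = c *\<^sub>R ev v x"
    and k_inner: "inner (k x a) v = inner a (ev v x)"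
    and ev_k: "ev (k x a) y = K y x *v a"
    and K_invertible: "invertible (K x x)"

lemma rkhs_fields_exist:
  fixes ev :: "'v::{real_inner,complete_space} \<Rightarrow> real^'n \<Rightarrow> real^'n"
  assumes e: "C2_embedded ev" and r: "reproducing_kernel ev K" and i: "\<And>x. invertible (K x x)"
  shows "\<exists>k C. rkhs_fields ev K k C"
proof -
  have "\<exists>k. \<forall>x a. ev (k x a) = (\<lambda>y. K y x *v a) \<and> (\<forall>v. inner (k x a) v = inner a (ev v x))"
    using r unfolding reproducing_kernel_def by metis
  then obtain k where k: "\<And>x a. ev (k x a) = (\<lambda>y. K y x *v a)"
    "\<And>x a v. inner (k x a) v = inner a (ev v x)" by metis
  obtain C where C: "\<And>v. C2_norm (ev v) \<le> C * norm v" using e unfolding C2_embedded_def by auto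
  let ?C = "max C 1"
  have C': "C2_norm (ev v) \<le> ?C * norm v" for v
    using C[of v] mult_right_mono[of C ?C "norm v"] by simp
  have van: "C2_vanishing (ev v)" for v using e unfolding C2_embedded_def by auto
  have "rkhs_fields ev K k ?C"
  proof
    show "norm (ev v x) \<le> ?C * norm v" for v x
      using C2_vanishing_bounds(1)[OF van] C' order_trans by blast
    show "norm (ev v x - ev v y) \<le> ?C * norm v * norm (x - y)" for v x y
      using C2_vanishing_bounds(2)[OF van, of v x y] mult_right_mono[OF C'[of v], of "norm (x - y)"] by simp
  qed (use e k i in \<open>auto simp: C2_embedded_def\<close>)
  then show ?thesis by blast
qed

context rkhs_fields
begin

lemma linear_ev: "linear (\<lambda>v. ev v x)"
  by (rule linearI) (simp_all add: ev_add ev_scale)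

lemma ev_diff: "ev (u - v) x = ev u x - ev v x"
  by (rule linear_diff[OF linear_ev])

lemma linear_k: "linear (k x)"
proof (rule linearI)
  show "k x (a + b) = k x a + k x b" for a b
    by (rule vector_eq_ldot[THEN iffD1]) (simp add: inner_add_left inner_add_right k_inner inner_commute[of _ "k _ _"] )
  show "k x (c *\<^sub>R a) = c *\<^sub>R k x a" for c a
    by (rule vector_eq_ldot[THEN iffD1]) (simp add: k_inner inner_commute[of _ "k _ _"])
qed

lemmas k_diff = linear_diff[OF linear_k]

text \<open>Pairing the representer with itself turns the evaluation bound into a quadratic
  inequality for its norm.\<close>

lemma norm_k: "norm (k x a) \<le> C * norm a"
proof -
  have "(norm (k x a))\<^sup>2 = inner a (ev (k x a) x)" by (simp add: power2_norm_eq_inner k_inner)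
  also have "\<dots> \<le> norm a * (C * norm (k x a))"
    using norm_cauchy_schwarz[of a "ev (k x a) x"] mult_left_mono[OF ev_bound[of "k x a" x] norm_ge_zero[of a]]
    by linarith
  finally have "(norm (k x a))\<^sup>2 \<le> (C * norm a) * norm (k x a)"
    by (simp add: ac_simps)
  then show ?thesis by (rule square_le_mult_imp_le) (use C_pos in auto)
qed

text \<open>The difference of two representers is itself a vector field; pairing it with itself
  brings in the difference of its values at \<open>x\<close> and \<open>y\<close>, which its own
  Lipschitz bound controls.\<close>

lemma k_lip: "norm (k x a - k y a) \<le> C * norm (x - y) * norm a"
proof -
  let ?w = "k x a - k y a"
  have "(norm ?w)\<^sup>2 = inner (k x a) ?w - inner (k y a) ?w"
    by (simp add: power2_norm_eq_inner inner_diff_left)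
  also have "\<dots> = inner a (ev ?w x - ev ?w y)"
    unfolding k_inner by (simp add: inner_diff_right)
  also have "\<dots> \<le> norm a * (C * norm ?w * norm (x - y))"
    using norm_cauchy_schwarz[of a "ev ?w x - ev ?w y"] mult_left_mono[OF ev_lip[of ?w x y] norm_ge_zero[of a]]
    by linarith
  finally have "(norm ?w)\<^sup>2 \<le> (C * norm (x - y) * norm a) * norm ?w"
    by (simp add: ac_simps)
  then show ?thesis by (rule square_le_mult_imp_le) (use C_pos in auto)
qed

lemma norm_k_change: "norm (k y a) \<le> norm (k x a) + C * norm (x - y) * norm a"
  using k_lip[of y a x] norm_triangle_sub[of "k y a" "k x a"] by (simp add: norm_minus_commute)

text \<open>A representer at \<open>x\<close> is orthogonal to every field vanishing at
  \<open>x\<close>, which is why this choice has least norm among the fields with value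
  \<open>h\<close> there. The matrix factor turns the velocity \<open>h\<close> into a
  momentum.\<close>

definition lift :: "real^'n \<Rightarrow> real^'n \<Rightarrow> 'v" where
  "lift x h = k x (matrix_inv (K x x) *v h)"

lemma linear_lift: "linear (lift x)"
  unfolding lift_def[abs_def]
  using linear_compose[OF matrix_vector_mul_linear linear_k] by (simp add: o_def)

lemmas lift_diff = linear_diff[OF linear_lift] and lift_add = linear_add[OF linear_lift]
  and lift_scale = linear_scale[OF linear_lift] and lift_0 = linear_0[OF linear_lift]

lemma K_matrix_inv: "K x x ** matrix_inv (K x x) = mat 1"
proof -
  have "\<exists>B. K x x ** B = mat 1 \<and> B ** K x x = mat 1"
    using K_invertible[of x] by (simp add: invertible_def)
  then show ?thesis unfolding matrix_inv_def by (rule someI2_ex) simp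
qed

lemma ev_lift: "ev (lift x h) x = h"
  by (simp add: lift_def ev_k matrix_vector_mul_assoc K_matrix_inv)

lemma inner_lift: "inner (k x a) (lift x h) = inner a h"
  by (simp add: k_inner ev_lift)

lemma norm_lift_sq: "(norm (lift x h))\<^sup>2 = inner (matrix_inv (K x x) *v h) h"
  using inner_lift[of x "matrix_inv (K x x) *v h" h] by (simp add: power2_norm_eq_inner lift_def)

lemma norm_lift: "norm (lift x h) = sqrt (kernel_metric K x h h)"
  using norm_lift_sq[of x h] by (simp add: kernel_metric_def inner_commute real_sqrt_unique)

lemma norm_le_lift: "norm h \<le> C * norm (lift x h)"
  using ev_bound[of "lift x h" x] by (simp add: ev_lift)

lemma lift_eq_0_iff: "lift x h = 0 \<longleftrightarrow> h = 0"
  using norm_le_lift[of h x] lift_0 by auto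

text \<open>At the momentum of \<open>h\<close> the pairing \<open>inner a h\<close> is the squared
  norm of the lift, so testing the assumed inequality on this single covector bounds that
  norm.\<close>

lemma norm_lift_le:
  assumes "\<And>a. inner a h \<le> T * norm (k x a) + B * norm a" 
    and "\<And>a. norm a \<le> M * norm (k x a)" and "T \<ge> 0" and "B \<ge> 0" and "M \<ge> 0"
  shows "norm (lift x h) \<le> T + B * M"
proof -
  let ?a = "matrix_inv (K x x) *v h"
  have "(norm (lift x h))\<^sup>2 \<le> T * norm (lift x h) + B * norm ?a"
    using assms(1)[of ?a] norm_lift_sq[of x h] by (simp add: lift_def)
  also have "\<dots> \<le> T * norm (lift x h) + B * (M * norm (lift x h))"
    using mult_left_mono[OF assms(2)[of ?a] assms(4)] by (simp add: lift_def)
  also have "\<dots> = (T + B * M) * norm (lift x h)" by (simp add: algebra_simps)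
  finally show ?thesis by (rule square_le_mult_imp_le) (use assms in auto)
qed

lemma k_inj:
  assumes "k x a = 0" shows "a = 0"
  using inner_lift[of x a a] assms by simp

lemma continuous_on_k:
  fixes g h :: "'b::topological_space \<Rightarrow> real^'n"
  assumes "continuous_on S g" and "continuous_on S h"
  shows "continuous_on S (\<lambda>t. k (g t) (h t))"
unfolding continuous_on_def
proof (rule ballI)
  fix t assume t: "t \<in> S"
  have gt: "(g \<longlongrightarrow> g t) (at t within S)" and ht: "(h \<longlongrightarrow> h t) (at t within S)"
    using assms t by (auto simp: continuous_on_def)
  have "((\<lambda>s. C * norm (g s - g t) * norm (h s) + C * norm (h s - h t)) \<longlongrightarrow>
      C * norm (g t - g t) * norm (h t) + C * norm (h t - h t)) (at t within S)"
    by (intro tendsto_intros gt ht)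
  then have lim: "((\<lambda>s. C * norm (g s - g t) * norm (h s) + C * norm (h s - h t)) \<longlongrightarrow> 0) (at t within S)"
    by simp
  have "norm (k (g s) (h s) - k (g t) (h t)) \<le> C * norm (g s - g t) * norm (h s) + C * norm (h s - h t)" for s
  proof -
    have "k (g s) (h s) - k (g t) (h t) = (k (g s) (h s) - k (g t) (h s)) + k (g t) (h s - h t)"
      by (simp add: k_diff)
    then have "norm (k (g s) (h s) - k (g t) (h t)) \<le> norm (k (g s) (h s) - k (g t) (h s)) + norm (k (g t) (h s - h t))"
      by (rule ord_eq_le_trans[OF arg_cong[where f = norm] norm_triangle_ineq])
    then show ?thesis
      using k_lip[of "g s" "h s" "g t"] norm_k[of "g t" "h s - h t"] by linarith
  qed
  then have "((\<lambda>s. k (g s) (h s) - k (g t) (h t)) \<longlongrightarrow> 0) (at t within S)"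
    by (intro Lim_null_comparison[OF always_eventually lim]) auto
  then show "((\<lambda>s. k (g s) (h s)) \<longlongrightarrow> k (g t) (h t)) (at t within S)"
    by (simp add: LIM_zero_iff)
qed

section \<open>Local uniformity of the kernel metric\<close>

definition coercive :: "real \<Rightarrow> real \<Rightarrow> bool" where
  "coercive R M \<longleftrightarrow> M > 0 \<and> (\<forall>x\<in>cball 0 R. \<forall>a. norm a \<le> M * norm (k x a))"

text \<open>Compactness makes the pointwise invertibility of \<open>K x x\<close> uniform on balls:
  \<open>norm (k x a)\<close> attains a minimum over base points in the ball and unit covectors,
  positive because \<open>k x\<close> is injective. Homogeneity extends the bound to all
  covectors.\<close>

lemma coercive_exists: "\<exists>M. coercive R M"
proof (cases "R \<ge> 0")
  case False
  then show ?thesis by (intro exI[of _ 1]) (auto simp: coercive_def)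
next
  case True
  let ?S = "cball (0::real^'n) R \<times> sphere (0::real^'n) 1"
  have "compact ?S" by (intro compact_Times) auto
  moreover have "?S \<noteq> {}" using True vector_choose_size[of 1] by fastforce
  moreover have "continuous_on ?S (\<lambda>p. norm (k (fst p) (snd p)))"
    by (intro continuous_on_norm continuous_on_k continuous_intros)
  ultimately obtain p where p: "p \<in> ?S" "\<And>y. y \<in> ?S \<Longrightarrow> norm (k (fst p) (snd p)) \<le> norm (k (fst y) (snd y))"
    using continuous_attains_inf[of ?S "\<lambda>p. norm (k (fst p) (snd p))"] by blast
  define m where "m = norm (k (fst p) (snd p))"
  have m: "m > 0" using p(1) k_inj[of "fst p" "snd p"] unfolding m_def by (cases p) auto
  have "norm a \<le> 1 / m * norm (k x a)" if "x \<in> cball 0 R" for x a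
  proof (cases "a = 0")
    case False
    have "(x, (1 / norm a) *\<^sub>R a) \<in> ?S" using that False by simp
    from p(2)[OF this] have "m \<le> norm (k x ((1 / norm a) *\<^sub>R a))" by (simp add: m_def)
    also have "\<dots> = norm (k x a) / norm a" by (simp add: linear_scale[OF linear_k])
    finally show ?thesis using m False by (simp add: field_simps)
  qed (use m in simp)
  then show ?thesis using m by (intro exI[of _ "1 / m"]) (auto simp: coercive_def)
qed

lemma coerciveD: "coercive R M \<Longrightarrow> norm x \<le> R \<Longrightarrow> norm a \<le> M * norm (k x a)"
  by (auto simp: coercive_def)

text \<open>The pairing \<open>inner a h\<close> does not depend on the base point. Writing it with
  the lift at \<open>x\<close> and moving the representer from \<open>x\<close> to \<open>y\<close>
  gives the hypothesis of \<open>norm_lift_le\<close> at \<open>y\<close>.\<close>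

lemma norm_lift_change:
  assumes "coercive R M" and "norm y \<le> R"
  shows "norm (lift y h) \<le> norm (lift x h) * (1 + C * M * norm (x - y))"
proof -
  have "norm (lift y h) \<le> norm (lift x h) + (norm (lift x h) * (C * norm (x - y))) * M"
  proof (rule norm_lift_le)
    fix a
    have "inner a h = inner (k x a) (lift x h)" by (simp add: inner_lift)
    also have "\<dots> \<le> norm (k x a) * norm (lift x h)" by (rule norm_cauchy_schwarz)
    also have "\<dots> \<le> (norm (k y a) + C * norm (x - y) * norm a) * norm (lift x h)"
      using norm_k_change[of x a y] by (intro mult_right_mono) (auto simp: norm_minus_commute)
    finally show "inner a h \<le> norm (lift x h) * norm (k y a) + norm (lift x h) * (C * norm (x - y)) * norm a"
      by (simp add: algebra_simps)
  qed (use assms C_pos in \<open>auto simp: coercive_def\<close>)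
  then show ?thesis by (simp add: algebra_simps)
qed

text \<open>One \<open>C\<^sup>2\<close> pays for moving the point of evaluation, the other for
  moving the centre of the representer.\<close>

lemma norm_K_diff: "norm (K x x *v b - K y y *v b) \<le> 2 * C\<^sup>2 * norm (x - y) * norm b"
proof -
  have "K x x *v b - K y y *v b = (ev (k x b) x - ev (k x b) y) + ev (k x b - k y b) y"
    by (simp add: ev_k ev_diff)
  then have "norm (K x x *v b - K y y *v b) \<le> norm (ev (k x b) x - ev (k x b) y) + norm (ev (k x b - k y b) y)"
    by (metis norm_triangle_ineq)
  moreover have "norm (ev (k x b) x - ev (k x b) y) \<le> C * (C * norm b) * norm (x - y)"
    by (rule order_trans[OF ev_lip]) (use C_pos norm_k[of x b] in \<open>intro mult_right_mono mult_left_mono, auto\<close>)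
  moreover have "norm (ev (k x b - k y b) y) \<le> C * (C * norm (x - y) * norm b)"
    by (rule order_trans[OF ev_bound]) (use C_pos k_lip[of x b y] in \<open>auto intro!: mult_left_mono\<close>)
  ultimately have "norm (K x x *v b - K y y *v b) \<le> C * (C * norm b) * norm (x - y) + C * (C * norm (x - y) * norm b)"
    by linarith
  then show ?thesis by (simp add: power2_eq_square ac_simps)
qed

text \<open>Applying \<open>K y y\<close> to the difference of the momenta leaves
  \<open>h' - h\<close> plus the change of the kernel. Coercivity then undoes \<open>K y y\<close>
  at the price of \<open>M\<^sup>2\<close>, so no formula for the derivative of the inverse matrix
  enters.\<close>

lemma norm_momentum_diff:
  assumes "coercive R M" and "norm y \<le> R"
  shows "norm (matrix_inv (K y y) *v h' - matrix_inv (K x x) *v h)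
    \<le> M\<^sup>2 * (norm (h' - h) + 2 * C\<^sup>2 * norm (x - y) * norm (matrix_inv (K x x) *v h))"
proof -
  let ?b = "matrix_inv (K x x) *v h"
  let ?a = "matrix_inv (K y y) *v h' - ?b"
  define e where "e = norm (h' - h) + 2 * C\<^sup>2 * norm (x - y) * norm ?b"
  have e: "e \<ge> 0" by (simp add: e_def)
  have M: "M > 0" using assms by (simp add: coercive_def)
  have "ev (k y ?a) y = K y y *v (matrix_inv (K y y) *v h') - K y y *v ?b"
    by (simp add: ev_k matrix_vector_mult_diff_distrib)
  also have "\<dots> = (h' - h) + (K x x *v ?b - K y y *v ?b)"
    by (simp add: matrix_vector_mul_assoc K_matrix_inv)
  finally have "norm (ev (k y ?a) y) \<le> e"
    using norm_triangle_ineq[of "h' - h" "K x x *v ?b - K y y *v ?b"] norm_K_diff[of x ?b y] by (simp add: e_def)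
  then have "norm ?a * norm (ev (k y ?a) y) \<le> norm ?a * e"
    by (rule mult_left_mono) (rule norm_ge_zero)
  moreover have "(norm (k y ?a))\<^sup>2 = inner ?a (ev (k y ?a) y)"
    unfolding power2_norm_eq_inner k_inner ..
  ultimately have "(norm (k y ?a))\<^sup>2 \<le> norm ?a * e"
    using norm_cauchy_schwarz[of ?a "ev (k y ?a) y"] by linarith
  moreover have "(norm ?a)\<^sup>2 \<le> M\<^sup>2 * (norm (k y ?a))\<^sup>2"
    using power_mono[OF coerciveD[OF assms, of ?a], of 2] by (simp add: power_mult_distrib)
  ultimately have "(norm ?a)\<^sup>2 \<le> M\<^sup>2 * (norm ?a * e)"
    by (rule order_trans[OF _ mult_left_mono[OF _ zero_le_power2], rotated])
  then have "(norm ?a)\<^sup>2 \<le> (M\<^sup>2 * e) * norm ?a"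
    by (simp only: mult.assoc mult.commute[of e])
  then show ?thesis unfolding e_def[symmetric] by (rule square_le_mult_imp_le) (simp add: e)
qed

lemma continuous_on_lift:
  fixes g h :: "'b::topological_space \<Rightarrow> real^'n"
  assumes "continuous_on S g" and "continuous_on S h"
  shows "continuous_on S (\<lambda>t. lift (g t) (h t))"
  unfolding lift_def
proof (intro continuous_on_k assms, unfold continuous_on_def, rule ballI)
  fix t assume t: "t \<in> S"
  have gt: "(g \<longlongrightarrow> g t) (at t within S)" and ht: "(h \<longlongrightarrow> h t) (at t within S)"
    using assms t by (auto simp: continuous_on_def)
  \<comment> \<open>The margin 1 keeps all \<open>g s\<close> with \<open>s\<close> near
    \<open>t\<close> inside the ball where \<open>M\<close> is valid.\<close>
  obtain M where M: "coercive (norm (g t) + 1) M" using coercive_exists by blast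
  let ?b = "\<lambda>s. matrix_inv (K (g s) (g s)) *v h s"
  have "((\<lambda>s. M\<^sup>2 * (norm (h s - h t) + 2 * C\<^sup>2 * norm (g t - g s) * norm (?b t))) \<longlongrightarrow>
      M\<^sup>2 * (norm (h t - h t) + 2 * C\<^sup>2 * norm (g t - g t) * norm (?b t))) (at t within S)"
    by (intro tendsto_intros gt ht)
  then have lim: "((\<lambda>s. M\<^sup>2 * (norm (h s - h t) + 2 * C\<^sup>2 * norm (g t - g s) * norm (?b t))) \<longlongrightarrow> 0) (at t within S)"
    by simp
  have "((\<lambda>s. norm (g s)) \<longlongrightarrow> norm (g t)) (at t within S)" by (intro tendsto_intros gt)
  then have "eventually (\<lambda>s. norm (g s) < norm (g t) + 1) (at t within S)"
    by (rule order_tendstoD) simp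
  then have "eventually (\<lambda>s. norm (?b s - ?b t) \<le> M\<^sup>2 * (norm (h s - h t) + 2 * C\<^sup>2 * norm (g t - g s) * norm (?b t))) (at t within S)"
    by eventually_elim (rule norm_momentum_diff[OF M], simp)
  then have "((\<lambda>s. ?b s - ?b t) \<longlongrightarrow> 0) (at t within S)"
    by (rule Lim_null_comparison[OF _ lim])
  then show "(?b \<longlongrightarrow> ?b t) (at t within S)" by (simp add: LIM_zero_iff)
qed

end

subsection \<open>A Zygmund criterion for continuous differentiability\<close>

text \<open>This closes the bisection below: passing to a half interval adds one error
  \<open>sqrt h\<close>, and the constant 4 absorbs it because 4 / sqrt 2 + 1 is less than
  4.\<close>

lemma sqrt_half_bound: "4 * sqrt (h / 2) + sqrt h \<le> 4 * sqrt h" if "h \<ge> 0"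
proof -
  have "sqrt (h / 2) \<le> 3 / 4 * sqrt h"
  proof (rule real_le_lsqrt)
    have "(3 / 4 * sqrt h)\<^sup>2 = 9 / 16 * h" using that by (simp add: power_mult_distrib power2_eq_square)
    then show "h / 2 \<le> (3 / 4 * sqrt h)\<^sup>2" using that by simp
  qed (use that in auto)
  then show ?thesis by linarith
qed

text \<open>Bisection towards \<open>q\<close>: by \<open>mid\<close>, the slopes over the two
  halves differ from the slope over the whole by at most \<open>A * sqrt (t - s)\<close>, and these
  errors sum geometrically. The factor \<open>q - s\<close> in the conclusion makes it an estimate
  between slopes.\<close>

lemma zygmund_one_sided:
  fixes z :: "real \<Rightarrow> 'a::banach"
  assumes lip: "\<And>s t. 0 \<le> s \<Longrightarrow> s \<le> t \<Longrightarrow> t \<le> T \<Longrightarrow> norm (z t - z s) \<le> L * (t - s)"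
    and mid: "\<And>s t. 0 \<le> s \<Longrightarrow> s < t \<Longrightarrow> t \<le> T \<Longrightarrow>
      norm (z s - 2 *\<^sub>R z ((s + t) / 2) + z t) \<le> A * (t - s) * sqrt (t - s)"
    and st: "0 \<le> s" "s < t" "t \<le> T" "s \<le> q" "q \<le> t"
  shows "norm (z q - z s - ((q - s) / (t - s)) *\<^sub>R (z t - z s)) \<le> 4 * A * sqrt (t - s) * (q - s)"
proof -
  have A: "A \<ge> 0"
  proof -
    have "0 \<le> A * ((t - s) * sqrt (t - s))" using mid[OF st(1-3)] norm_ge_zero order_trans by (metis mult.assoc)
    moreover have "0 < (t - s) * sqrt (t - s)" using st by simp
    ultimately show ?thesis by (metis mult.commute zero_le_mult_iff not_le)
  qed
  \<comment> \<open>The last summand is the crude Lipschitz bound on the interval that remains after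
    \<open>n\<close> bisections; it vanishes in the limit.\<close>
  have "norm (z q - z s - ((q - s) / (t - s)) *\<^sub>R (z t - z s)) \<le> 4 * A * sqrt (t - s) * (q - s) + 2 * L * (t - s) / 2 ^ n" for n
    using st
  proof (induction n arbitrary: s t)
    case 0
    have "norm (z q - z s) \<le> L * (t - s)"
      using lip[of s q] lip[of s t] 0 mult_left_mono[of "q - s" "t - s" L]
      by (smt (verit, best) mult_nonneg_nonneg norm_ge_zero zero_le_mult_iff)
    moreover have "norm (((q - s) / (t - s)) *\<^sub>R (z t - z s)) \<le> 1 * (L * (t - s))"
      unfolding norm_scaleR using lip[of s t] 0 by (intro mult_mono) auto
    ultimately have "norm (z q - z s - ((q - s) / (t - s)) *\<^sub>R (z t - z s)) \<le> 2 * L * (t - s)"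
      using norm_triangle_ineq4[of "z q - z s" "((q - s) / (t - s)) *\<^sub>R (z t - z s)"] by simp
    moreover have "0 \<le> 4 * A * sqrt (t - s) * (q - s)" using A 0 by simp
    ultimately show ?case unfolding power_0 div_by_1 by linarith
  next
    case (Suc n)
    define h where "h = t - s"
    define m where "m = (s + t) / 2"
    define d where "d = (1 / h) *\<^sub>R (z t - z s)"
    define d1 where "d1 = (2 / h) *\<^sub>R (z m - z s)"
    define d2 where "d2 = (2 / h) *\<^sub>R (z t - z m)"
    have h: "h > 0" and mh: "m - s = h / 2" "t - m = h / 2" using Suc.prems by (auto simp: h_def m_def field_simps)
    have split: "norm (((2::real) / h) *\<^sub>R w - (1 / h) *\<^sub>R v) = norm (2 *\<^sub>R w - v) / h" for w v :: 'a
    proof -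
      have "(2 / h) *\<^sub>R w - (1 / h) *\<^sub>R v = (1 / h) *\<^sub>R (2 *\<^sub>R w - v)" by (simp add: algebra_simps)
      then show ?thesis using h by simp
    qed
    have M: "norm (z s - 2 *\<^sub>R z m + z t) \<le> A * sqrt h * h"
      using mid[of s t] Suc.prems by (simp add: h_def m_def mult.assoc mult.commute[of "t - s"])
    have "2 *\<^sub>R (z m - z s) - (z t - z s) = - (z s - 2 *\<^sub>R z m + z t)"
         "2 *\<^sub>R (z t - z m) - (z t - z s) = z s - 2 *\<^sub>R z m + z t"
      by (simp_all add: algebra_simps scaleR_2)
    then have "norm (2 *\<^sub>R (z m - z s) - (z t - z s)) \<le> A * sqrt h * h"
      "norm (2 *\<^sub>R (z t - z m) - (z t - z s)) \<le> A * sqrt h * h"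
      using M by (simp_all only: norm_minus_cancel)
    then have dd: "norm (d1 - d) \<le> A * sqrt h" "norm (d2 - d) \<le> A * sqrt h"
      unfolding d1_def d2_def d_def split by (simp_all only: pos_divide_le_eq[OF h])
    have goal: "((q - s) / (t - s)) *\<^sub>R (z t - z s) = (q - s) *\<^sub>R d"
      by (simp add: d_def h_def)
    show ?case
    proof (cases "q \<le> m")
      case True
      have "norm (z q - z s - ((q - s) / (m - s)) *\<^sub>R (z m - z s)) \<le> 4 * A * sqrt (m - s) * (q - s) + 2 * L * (m - s) / 2 ^ n"
        using Suc.prems True mh h by (intro Suc.IH) auto
      moreover have "((q - s) / (m - s)) *\<^sub>R (z m - z s) = (q - s) *\<^sub>R d1" by (simp add: mh d1_def)
      ultimately have 1: "norm (z q - z s - (q - s) *\<^sub>R d1) \<le> 4 * A * sqrt (h / 2) * (q - s) + L * h / 2 ^ n"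
        by (simp add: mh)
      have 2: "norm ((q - s) *\<^sub>R (d1 - d)) \<le> (q - s) * (A * sqrt h)"
        unfolding norm_scaleR using Suc.prems dd by (simp add: mult_left_mono)
      have "z q - z s - (q - s) *\<^sub>R d = (z q - z s - (q - s) *\<^sub>R d1) + (q - s) *\<^sub>R (d1 - d)"
        by (simp add: algebra_simps)
      then have "norm (z q - z s - (q - s) *\<^sub>R d) \<le> norm (z q - z s - (q - s) *\<^sub>R d1) + norm ((q - s) *\<^sub>R (d1 - d))"
        by (rule ord_eq_le_trans[OF arg_cong[where f = norm] norm_triangle_ineq])
      then have "norm (z q - z s - (q - s) *\<^sub>R d) \<le> 4 * A * sqrt (h / 2) * (q - s) + L * h / 2 ^ n + (q - s) * (A * sqrt h)"
        using 1 2 by linarith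
      also have "\<dots> = A * (q - s) * (4 * sqrt (h / 2) + sqrt h) + L * h / 2 ^ n" by (simp add: algebra_simps)
      also have "\<dots> \<le> A * (q - s) * (4 * sqrt h) + L * h / 2 ^ n"
        using sqrt_half_bound[of h] h A Suc.prems by (intro add_right_mono mult_left_mono) auto
      finally show ?thesis unfolding goal by (simp add: h_def[symmetric] ac_simps)
    next
      case False
      have "norm (z q - z m - ((q - m) / (t - m)) *\<^sub>R (z t - z m)) \<le> 4 * A * sqrt (t - m) * (q - m) + 2 * L * (t - m) / 2 ^ n"
        using Suc.prems False mh h by (intro Suc.IH) auto
      moreover have "((q - m) / (t - m)) *\<^sub>R (z t - z m) = (q - m) *\<^sub>R d2" by (simp add: mh d2_def)
      ultimately have 1: "norm (z q - z m - (q - m) *\<^sub>R d2) \<le> 4 * A * sqrt (h / 2) * (q - m) + L * h / 2 ^ n"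
        by (simp add: mh)
      have 2: "norm ((q - m) *\<^sub>R (d2 - d)) \<le> (q - m) * (A * sqrt h)"
        unfolding norm_scaleR using False dd by (simp add: mult_left_mono)
      have 3: "norm ((m - s) *\<^sub>R (d1 - d)) \<le> (m - s) * (A * sqrt h)"
        unfolding norm_scaleR using dd mh h by (simp add: mult_left_mono)
      \<comment> \<open>When \<open>q\<close> lies in the right half, the increment over the whole
        left half also has to be compared with the slope \<open>d\<close>.\<close>
      have "z m - z s = (m - s) *\<^sub>R d1" using h by (simp add: mh d1_def)
      then have "z q - z s - (q - s) *\<^sub>R d = (z q - z m - (q - m) *\<^sub>R d2) + ((q - m) *\<^sub>R (d2 - d) + (m - s) *\<^sub>R (d1 - d))"
        by (simp add: algebra_simps)
      then have "norm (z q - z s - (q - s) *\<^sub>R d) \<le> norm (z q - z m - (q - m) *\<^sub>R d2) + norm ((q - m) *\<^sub>R (d2 - d) + (m - s) *\<^sub>R (d1 - d))"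
        by (rule ord_eq_le_trans[OF arg_cong[where f = norm] norm_triangle_ineq])
      then have "norm (z q - z s - (q - s) *\<^sub>R d) \<le> 4 * A * sqrt (h / 2) * (q - m) + L * h / 2 ^ n + ((q - m) * (A * sqrt h) + (m - s) * (A * sqrt h))"
        using norm_triangle_ineq[of "(q - m) *\<^sub>R (d2 - d)" "(m - s) *\<^sub>R (d1 - d)"] 1 2 3 by linarith
      also have "\<dots> = A * (q - m) * (4 * sqrt (h / 2) + sqrt h) + (m - s) * A * sqrt h + L * h / 2 ^ n" by (simp add: algebra_simps)
      also have "\<dots> \<le> A * (q - m) * (4 * sqrt h) + (m - s) * A * (4 * sqrt h) + L * h / 2 ^ n"
        using sqrt_half_bound[of h] h A False mh by (intro add_mono mult_left_mono) auto
      also have "\<dots> = 4 * A * sqrt h * (q - s) + L * h / 2 ^ n" by (simp add: algebra_simps)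
      finally show ?thesis unfolding goal by (simp add: h_def[symmetric] ac_simps)
    qed
  qed
  then have "eventually (\<lambda>n. norm (z q - z s - ((q - s) / (t - s)) *\<^sub>R (z t - z s)) \<le> 4 * A * sqrt (t - s) * (q - s) + 2 * L * (t - s) / 2 ^ n) sequentially"
    by (intro always_eventually allI)
  moreover have "(\<lambda>n. 4 * A * sqrt (t - s) * (q - s) + 2 * L * (t - s) / 2 ^ n) \<longlonglongrightarrow> 4 * A * sqrt (t - s) * (q - s) + 0"
  proof (intro tendsto_add tendsto_const)
    have "(\<lambda>n. 2 * L * (t - s) * (1 / 2) ^ n) \<longlonglongrightarrow> 2 * L * (t - s) * 0"
      by (intro tendsto_mult tendsto_const LIMSEQ_realpow_zero) auto
    then show "(\<lambda>n. 2 * L * (t - s) / 2 ^ n) \<longlonglongrightarrow> 0" by (simp add: power_one_over)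
  qed
  ultimately have "norm (z q - z s - ((q - s) / (t - s)) *\<^sub>R (z t - z s)) \<le> 4 * A * sqrt (t - s) * (q - s) + 0"
    by (intro tendsto_lowerbound[where F = sequentially]) auto
  then show ?thesis by simp
qed

text \<open>By the one-sided estimate the slopes from \<open>s\<close> to a point decreasing to
  \<open>s\<close> form a Cauchy family. Its limit is the right derivative, and the rate survives
  the limit.\<close>

lemma zygmund_right_slope:
  fixes z :: "real \<Rightarrow> 'a::banach"
  assumes lip: "\<And>s t. 0 \<le> s \<Longrightarrow> s \<le> t \<Longrightarrow> t \<le> T \<Longrightarrow> norm (z t - z s) \<le> L * (t - s)"
    and mid: "\<And>s t. 0 \<le> s \<Longrightarrow> s < t \<Longrightarrow> t \<le> T \<Longrightarrow>
      norm (z s - 2 *\<^sub>R z ((s + t) / 2) + z t) \<le> A * (t - s) * sqrt (t - s)"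
  shows "\<exists>u. \<forall>s t. 0 \<le> s \<and> s < t \<and> t \<le> T \<longrightarrow>
    norm ((1 / (t - s)) *\<^sub>R (z t - z s) - u s) \<le> 4 * A * sqrt (t - s)"
proof -
  have "\<exists>v. \<forall>t. s < t \<and> t \<le> T \<longrightarrow>
    norm ((1 / (t - s)) *\<^sub>R (z t - z s) - v) \<le> 4 * A * sqrt (t - s)" if s: "0 \<le> s" "s < T" for s
  proof -
    define d where "d t = (1 / (t - s)) *\<^sub>R (z t - z s)" for t
    have key: "norm (d q - d t) \<le> 4 * A * sqrt (t - s)" if "s < q" "q \<le> t" "t \<le> T" for q t
    proof -
      have "norm (z q - z s - ((q - s) / (t - s)) *\<^sub>R (z t - z s)) \<le> 4 * A * sqrt (t - s) * (q - s)"
        using that s by (intro zygmund_one_sided[OF lip mid]) auto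
      moreover have "z q - z s - ((q - s) / (t - s)) *\<^sub>R (z t - z s) = (q - s) *\<^sub>R (d q - d t)"
        using that by (simp add: d_def scaleR_diff_right)
      ultimately show ?thesis using that by (simp add: mult.commute[of _ "q - s"] mult_le_cancel_left)
    qed
    define p where "p n = s + (T - s) / real (Suc n)" for n
    have p: "s < p n" "p n \<le> T" for n
      using s mult_left_mono[of 1 "real (Suc n)" "T - s"] by (auto simp: p_def pos_divide_le_eq le_diff_eq[symmetric] add.commute[of s])
    have pm: "p n \<le> p m" if "m \<le> n" for m n
      using s that by (auto simp: p_def intro!: divide_left_mono)
    have pl: "p \<longlonglongrightarrow> s"
    proof -
      have "(\<lambda>n. s + (T - s) * inverse (real (Suc n))) \<longlonglongrightarrow> s + (T - s) * 0"
        by (intro tendsto_intros LIMSEQ_inverse_real_of_nat)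
      then show ?thesis by (simp add: p_def[abs_def] divide_inverse)
    qed
    have small: "(\<lambda>n. 4 * A * sqrt (p n - s)) \<longlonglongrightarrow> 0"
      using tendsto_mult[OF tendsto_const[of "4 * A"] tendsto_real_sqrt[OF tendsto_diff[OF pl tendsto_const[of s]]]] by simp
    have "Cauchy (\<lambda>n. d (p n))"
    proof (rule CauchyI')
      fix e :: real assume "0 < e"
      then obtain M where M: "\<And>n. n \<ge> M \<Longrightarrow> 4 * A * sqrt (p n - s) < e"
        using order_tendstoD(2)[OF small] by (auto simp: eventually_sequentially)
      show "\<exists>M. \<forall>m\<ge>M. \<forall>n>m. dist (d (p m)) (d (p n)) < e"
      proof (intro exI allI impI)
        fix m n assume "M \<le> m" "m < n"
        then show "dist (d (p m)) (d (p n)) < e"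
          using key[OF p(1)[of n] pm[of m n] p(2)[of m]] M[of m] by (simp add: dist_norm norm_minus_commute)
      qed
    qed
    then obtain v where v: "(\<lambda>n. d (p n)) \<longlonglongrightarrow> v"
      using Cauchy_convergent_iff convergent_def by blast
    have "norm (d t - v) \<le> 4 * A * sqrt (t - s)" if t: "s < t" "t \<le> T" for t
    proof (rule tendsto_upperbound)
      show "(\<lambda>n. norm (d t - d (p n))) \<longlonglongrightarrow> norm (d t - v)" by (intro tendsto_intros v)
      have "eventually (\<lambda>n. p n < t) sequentially" using order_tendstoD(2)[OF pl] t by auto
      then show "eventually (\<lambda>n. norm (d t - d (p n)) \<le> 4 * A * sqrt (t - s)) sequentially"
      proof eventually_elim
        case (elim n)
        then show ?case using key[OF p(1)[of n], of t] t by (simp add: norm_minus_commute)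
      qed
    qed auto
    then show ?thesis by (auto simp: d_def)
  qed
  then have "\<forall>s. \<exists>v. 0 \<le> s \<and> s < T \<longrightarrow> (\<forall>t. s < t \<and> t \<le> T \<longrightarrow>
    norm ((1 / (t - s)) *\<^sub>R (z t - z s) - v) \<le> 4 * A * sqrt (t - s))" by blast
  then obtain u where "\<And>s t. 0 \<le> s \<Longrightarrow> s < T \<Longrightarrow> s < t \<Longrightarrow> t \<le> T \<Longrightarrow>
    norm ((1 / (t - s)) *\<^sub>R (z t - z s) - u s) \<le> 4 * A * sqrt (t - s)" by metis
  then show ?thesis by (intro exI[of _ u]) auto
qed

lemma slope_commute: "(1 / (t - s)) *\<^sub>R (x - y) = (1 / (s - t)) *\<^sub>R (y - x)"
  for t s :: real and x y :: "'a::real_vector"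
proof -
  have "1 / (t - s) = - (1 / (s - t))" unfolding minus_divide_right minus_diff_eq ..
  then show ?thesis by (simp only:) (simp add: scaleR_diff_right)
qed

text \<open>The two one-sided derivatives agree because the slopes over adjacent intervals of equal length
  differ by a second difference.\<close>

lemma zygmund_C1:
  fixes z :: "real \<Rightarrow> 'a::banach"
  assumes lip: "\<And>s t. 0 \<le> s \<Longrightarrow> s \<le> t \<Longrightarrow> t \<le> T \<Longrightarrow> norm (z t - z s) \<le> L * (t - s)"
    and mid: "\<And>s t. 0 \<le> s \<Longrightarrow> s < t \<Longrightarrow> t \<le> T \<Longrightarrow>
      norm (z s - 2 *\<^sub>R z ((s + t) / 2) + z t) \<le> A * (t - s) * sqrt (t - s)"
  shows "\<exists>u. continuous_on {0..T} u \<and> (\<forall>t\<in>{0..T}. (z has_vector_derivative u t) (at t within {0..T}))"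
proof -
  obtain u where u: "\<And>s t. 0 \<le> s \<Longrightarrow> s < t \<Longrightarrow> t \<le> T \<Longrightarrow>
      norm ((1 / (t - s)) *\<^sub>R (z t - z s) - u s) \<le> 4 * A * sqrt (t - s)"
    using zygmund_right_slope[of T z L A, OF lip mid] by auto
  \<comment> \<open>Time reversal turns right slopes into left slopes.\<close>
  have "\<exists>w. \<forall>s t. 0 \<le> s \<and> s < t \<and> t \<le> T \<longrightarrow>
    norm ((1 / (t - s)) *\<^sub>R (z (T - t) - z (T - s)) - w s) \<le> 4 * A * sqrt (t - s)"
  proof (rule zygmund_right_slope)
    fix s t :: real assume st: "0 \<le> s" "s \<le> t" "t \<le> T"
    then show "norm (z (T - t) - z (T - s)) \<le> L * (t - s)"
      using lip[of "T - t" "T - s"] by (simp add: norm_minus_commute)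
  next
    fix s t :: real assume st: "0 \<le> s" "s < t" "t \<le> T"
    have "(T - t + (T - s)) / 2 = T - (s + t) / 2" by (simp add: field_simps)
    moreover have "T - s - (T - t) = t - s" by simp
    moreover have "z (T - s) - 2 *\<^sub>R z (T - (s + t) / 2) + z (T - t) = z (T - t) - 2 *\<^sub>R z (T - (s + t) / 2) + z (T - s)"
      by simp
    ultimately show "norm (z (T - s) - 2 *\<^sub>R z (T - (s + t) / 2) + z (T - t)) \<le> A * (t - s) * sqrt (t - s)"
      using mid[of "T - t" "T - s"] st by (simp only: diff_ge_0_iff_ge diff_left_mono)
  qed
  then obtain w' where w': "\<And>s t. 0 \<le> s \<Longrightarrow> s < t \<Longrightarrow> t \<le> T \<Longrightarrow>
      norm ((1 / (t - s)) *\<^sub>R (z (T - t) - z (T - s)) - w' s) \<le> 4 * A * sqrt (t - s)" by auto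
  define w where "w t = - w' (T - t)" for t
  have w: "norm ((1 / (t - s)) *\<^sub>R (z t - z s) - w t) \<le> 4 * A * sqrt (t - s)" if "0 \<le> s" "s < t" "t \<le> T" for s t
  proof -
    have "(1 / (t - s)) *\<^sub>R (z t - z s) - w t = - ((1 / (t - s)) *\<^sub>R (z s - z t) - w' (T - t))"
      by (simp add: w_def algebra_simps)
    then show ?thesis using w'[of "T - t" "T - s"] that by (metis (no_types, lifting) diff_diff_eq2 diff_add_cancel
          add_diff_cancel_left' diff_ge_0_iff_ge diff_left_mono diff_strict_left_mono norm_minus_cancel diff_zero add.commute)
  qed
  have uw: "u s = w s" if s: "0 < s" "s < T" for s
  proof -
    \<comment> \<open>The three summands are the errors of the right slope, of the second difference
      over \<open>2 * h\<close>, and of the left slope.\<close>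
    define c where "c h = (4 * A + 2 * A * sqrt 2 + 4 * A) * sqrt h" for h
    have "norm (u s - w s) \<le> c h" if h: "0 < h" "h < min s (T - s)" for h
    proof -
      have 1: "norm ((1 / h) *\<^sub>R (z (s + h) - z s) - u s) \<le> 4 * A * sqrt h"
        using u[of s "s + h"] s h by simp
      have 2: "norm ((1 / h) *\<^sub>R (z s - z (s - h)) - w s) \<le> 4 * A * sqrt h"
        using w[of "s - h" s] s h by simp
      have "norm (z (s - h) - 2 *\<^sub>R z s + z (s + h)) \<le> A * (2 * h) * sqrt (2 * h)"
        using mid[of "s - h" "s + h"] s h by simp
      then have "(1 / h) * norm (z (s - h) - 2 *\<^sub>R z s + z (s + h)) \<le> 2 * A * sqrt 2 * sqrt h"
        using h by (simp add: real_sqrt_mult field_simps)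
      moreover have "(1 / h) *\<^sub>R (z (s + h) - z s) - (1 / h) *\<^sub>R (z s - z (s - h)) = (1 / h) *\<^sub>R (z (s - h) - 2 *\<^sub>R z s + z (s + h))"
        by (simp add: algebra_simps scaleR_2)
      ultimately have 3: "norm ((1 / h) *\<^sub>R (z (s + h) - z s) - (1 / h) *\<^sub>R (z s - z (s - h))) \<le> 2 * A * sqrt 2 * sqrt h"
        using h by simp
      have "norm (u s - w s) \<le> norm (a - u s) + norm (a - b) + norm (b - w s)" for a b
        using dist_triangle[of "u s" "w s" a] dist_triangle[of a "w s" b] by (simp add: dist_norm norm_minus_commute)
      from this[of "(1 / h) *\<^sub>R (z (s + h) - z s)" "(1 / h) *\<^sub>R (z s - z (s - h))"] 1 2 3
      show ?thesis unfolding c_def distrib_right by linarith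
    qed
    then have "eventually (\<lambda>h. norm (u s - w s) \<le> c h) (at_right 0)"
      unfolding eventually_at_right_field using s by (intro exI[of _ "min s (T - s)"]) auto
    moreover have "(c \<longlongrightarrow> (4 * A + 2 * A * sqrt 2 + 4 * A) * sqrt 0) (at_right 0)"
      unfolding c_def[abs_def] by (intro tendsto_intros)
    ultimately have "norm (u s - w s) \<le> (4 * A + 2 * A * sqrt 2 + 4 * A) * sqrt 0"
      by (intro tendsto_lowerbound[where F = "at_right 0" and f = c]) auto
    then show ?thesis by simp
  qed
  \<comment> \<open>The right slope says nothing about \<open>u\<close> at \<open>T\<close>, so the
    left slope takes over there.\<close>
  define v where "v t = (if t < T then u t else w t)" for t
  have v: "norm ((1 / (t - s)) *\<^sub>R (z t - z s) - v s) \<le> 4 * A * sqrt (t - s)"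
     "norm ((1 / (t - s)) *\<^sub>R (z t - z s) - v t) \<le> 4 * A * sqrt (t - s)" if "0 \<le> s" "s < t" "t \<le> T" for s t
    using that u[OF that] w[OF that] uw[of t] by (auto simp: v_def)
  have slope: "norm ((1 / (t - s)) *\<^sub>R (z t - z s) - v s) \<le> 4 * A * sqrt \<bar>t - s\<bar>" if "s \<in> {0..T}" "t \<in> {0..T}" "t \<noteq> s" for s t
  proof (cases "s < t")
    case True then show ?thesis using v(1)[of s t] that by simp
  next
    case False
    have "(1 / (t - s)) *\<^sub>R (z t - z s) = (1 / (s - t)) *\<^sub>R (z s - z t)"
      by (rule slope_commute)
    then show ?thesis using v(2)[of t s] that False by simp
  qed
  have der: "(z has_vector_derivative v s) (at s within {0..T})" if s: "s \<in> {0..T}" for s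
    unfolding has_vector_derivative_def has_derivative_within'
  proof (intro conjI allI impI)
    show "bounded_linear (\<lambda>h. h *\<^sub>R v s)" by (rule bounded_linear_scaleR_left)
    fix e :: real assume e: "0 < e"
    have "((\<lambda>h. 4 * A * sqrt \<bar>h\<bar>) \<longlongrightarrow> 4 * A * sqrt \<bar>0\<bar>) (at 0)" by (intro tendsto_intros)
    then have "eventually (\<lambda>h. 4 * A * sqrt \<bar>h\<bar> < e) (at 0)" using e order_tendstoD(2) by fastforce
    then obtain r where r: "r > 0" "\<And>h. h \<noteq> 0 \<Longrightarrow> \<bar>h\<bar> < r \<Longrightarrow> 4 * A * sqrt \<bar>h\<bar> < e"
      by (auto simp: eventually_at)
    show "\<exists>d>0. \<forall>x'\<in>{0..T}. 0 < norm (x' - s) \<and> norm (x' - s) < d \<longrightarrow>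
        norm (z x' - z s - (x' - s) *\<^sub>R v s) / norm (x' - s) < e"
    proof (intro exI[of _ r] conjI ballI impI r)
      fix t assume t: "t \<in> {0..T}" "0 < norm (t - s) \<and> norm (t - s) < r"
      have "z t - z s - (t - s) *\<^sub>R v s = (t - s) *\<^sub>R ((1 / (t - s)) *\<^sub>R (z t - z s) - v s)"
        using t by (simp add: algebra_simps)
      then have "norm (z t - z s - (t - s) *\<^sub>R v s) / norm (t - s) = norm ((1 / (t - s)) *\<^sub>R (z t - z s) - v s)"
        using t by simp
      then show "norm (z t - z s - (t - s) *\<^sub>R v s) / norm (t - s) < e"
        using slope[OF s t(1)] r(2)[of "t - s"] t by auto
    qed
  qed
  have "continuous_on {0..T} v"
  proof (unfold continuous_on_def, rule ballI)
    fix s assume s: "s \<in> {0..T}"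
    \<comment> \<open>Both derivatives are compared with the slope of the common chord, hence twice
      the constant 4.\<close>
    have vv: "norm (v t - v s) \<le> 8 * A * sqrt \<bar>t - s\<bar>" if "t \<in> {0..T}" "t \<noteq> s" for t
    proof -
      have "(1 / (t - s)) *\<^sub>R (z t - z s) = (1 / (s - t)) *\<^sub>R (z s - z t)"
        by (rule slope_commute)
      then show ?thesis
        using norm_triangle_ineq4[of "(1 / (t - s)) *\<^sub>R (z t - z s) - v s" "(1 / (s - t)) *\<^sub>R (z s - z t) - v t"]
          slope[OF s that(1)] slope[OF that(1) s] that by (simp add: abs_minus_commute)
    qed
    have "((\<lambda>t. 8 * A * sqrt \<bar>t - s\<bar>) \<longlongrightarrow> 8 * A * sqrt \<bar>s - s\<bar>) (at s within {0..T})" by (intro tendsto_intros)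
    then have lim: "((\<lambda>t. 8 * A * sqrt \<bar>t - s\<bar>) \<longlongrightarrow> 0) (at s within {0..T})" by simp
    have "eventually (\<lambda>t. norm (v t - v s) \<le> 8 * A * sqrt \<bar>t - s\<bar>) (at s within {0..T})"
      unfolding eventually_at_filter using vv by (intro always_eventually allI impI)
    then have "((\<lambda>t. v t - v s) \<longlongrightarrow> 0) (at s within {0..T})"
      by (rule Lim_null_comparison[OF _ lim])
    then show "(v \<longlongrightarrow> v s) (at s within {0..T})" by (simp add: LIM_zero_iff)
  qed
  with der show ?thesis by blast
qed

subsection \<open>Paths of unit speed\<close>

context rkhs_fields
begin

text \<open>The last term pays for the drift of \<open>norm (k (z \<tau>) a)\<close> along the path: both \<open>k\<close> and \<open>z\<close> are
  Lipschitz with constant \<open>C\<close>.\<close>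

definition upath :: "real \<Rightarrow> (real \<Rightarrow> real^'n) \<Rightarrow> bool" where
  "upath T z \<longleftrightarrow> T \<ge> 0 \<and> (\<forall>s t. 0 \<le> s \<and> s \<le> t \<and> t \<le> T \<longrightarrow>
     norm (z t - z s) \<le> C * (t - s) \<and>
     (\<forall>a. inner a (z t - z s) \<le> (t - s) * (norm (k (z s) a) + C\<^sup>2 * (t - s) * norm a)))"

definition reach :: "real \<Rightarrow> real^'n \<Rightarrow> real^'n \<Rightarrow> bool" where
  "reach T x y \<longleftrightarrow> (\<exists>z. upath T z \<and> z 0 = x \<and> z T = y)"

lemma upathD:
  assumes "upath T z" "0 \<le> s" "s \<le> t" "t \<le> T"
  shows "norm (z t - z s) \<le> C * (t - s)"
    and "inner a (z t - z s) \<le> (t - s) * (norm (k (z s) a) + C\<^sup>2 * (t - s) * norm a)"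
  using assms unfolding upath_def by blast+

lemma reach_nonneg: "reach T x y \<Longrightarrow> T \<ge> 0"
  unfolding reach_def upath_def by blast

lemma upath_reach:
  assumes "upath T z" "0 \<le> s" "s \<le> t" "t \<le> T"
  shows "reach (t - s) (z s) (z t)"
  unfolding reach_def
proof (intro exI conjI)
  show "upath (t - s) (\<lambda>\<tau>. z (s + \<tau>))"
    unfolding upath_def
  proof (intro conjI allI impI)
    fix p q a assume pq: "0 \<le> p \<and> p \<le> q \<and> q \<le> t - s"
    show "norm (z (s + q) - z (s + p)) \<le> C * (q - p)"
      using upathD(1)[OF assms(1), of "s + p" "s + q"] pq assms by simp
    show "inner a (z (s + q) - z (s + p)) \<le> (q - p) * (norm (k (z (s + p)) a) + C\<^sup>2 * (q - p) * norm a)"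
      using upathD(2)[OF assms(1), of "s + p" "s + q" a] pq assms by simp
  qed (use assms in simp)
qed simp_all

text \<open>Only increments across the junction need care: the second piece is controlled by the
  representer at the junction and has to be restated at the earlier point
  \<open>z s\<close>.\<close>

lemma reach_trans:
  assumes "reach T x y" and "reach S y w"
  shows "reach (T + S) x w"
proof -
  obtain z where z: "upath T z" "z 0 = x" "z T = y" using assms(1) unfolding reach_def by blast
  obtain z' where z': "upath S z'" "z' 0 = y" "z' S = w" using assms(2) unfolding reach_def by blast
  have TS: "T \<ge> 0" "S \<ge> 0" using assms reach_nonneg by auto
  define f where "f t = (if t \<le> T then z t else z' (t - T))" for t
  have "upath (T + S) f"
    unfolding upath_def
  proof (intro conjI allI impI)
    fix s t a assume st: "0 \<le> s \<and> s \<le> t \<and> t \<le> T + S"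
    consider "t \<le> T" | "T < s" | "s \<le> T" "T < t" by linarith
    then have "norm (f t - f s) \<le> C * (t - s) \<and>
      inner a (f t - f s) \<le> (t - s) * (norm (k (f s) a) + C\<^sup>2 * (t - s) * norm a)"
    proof cases
      case 1
      then show ?thesis using upathD[OF z(1), of s t] st by (simp add: f_def)
    next
      case 2
      then show ?thesis using upathD[OF z'(1), of "s - T" "t - T"] st by (simp add: f_def)
    next
      case 3
      have f: "f s = z s" "f t = z' (t - T)" using 3 by (auto simp: f_def)
      have split: "f t - f s = (z' (t - T) - z' 0) + (z T - z s)" by (simp add: f z z')
      have 1: "norm (z T - z s) \<le> C * (T - s)" and
        2: "inner a (z T - z s) \<le> (T - s) * (norm (k (z s) a) + C\<^sup>2 * (T - s) * norm a)"
        using upathD[OF z(1), of s T] 3 st by auto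
      have 3: "norm (z' (t - T) - z' 0) \<le> C * (t - T)" and
        4: "inner a (z' (t - T) - z' 0) \<le> (t - T) * (norm (k (z' 0) a) + C\<^sup>2 * (t - T) * norm a)"
        using upathD[OF z'(1), of 0 "t - T"] \<open>T < t\<close> st by auto
      have n: "norm (f t - f s) \<le> C * (t - s)"
        unfolding split using norm_triangle_ineq[of "z' (t - T) - z' 0" "z T - z s"] 1 3 by (simp add: algebra_simps)
      \<comment> \<open>The change of base point costs \<open>C\<^sup>2 * (T - s)\<close>, which
        adds up with the drift \<open>C\<^sup>2 * (t - T)\<close> to exactly
        \<open>C\<^sup>2 * (t - s)\<close>.\<close>
      have "norm (k (z' 0) a) \<le> norm (k (z s) a) + C * norm (z s - z T) * norm a"
        using norm_k_change[of "z T" a "z s"] z z' by simp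
      also have "\<dots> \<le> norm (k (z s) a) + C * (C * (T - s)) * norm a"
        using 1 C_pos by (intro add_left_mono mult_right_mono mult_left_mono) (auto simp: norm_minus_commute)
      finally have "(t - T) * (norm (k (z' 0) a) + C\<^sup>2 * (t - T) * norm a)
          \<le> (t - T) * ((norm (k (z s) a) + C * (C * (T - s)) * norm a) + C\<^sup>2 * (t - T) * norm a)"
        using \<open>T < t\<close> by (intro mult_left_mono add_right_mono) auto
      also have "\<dots> = (t - T) * (norm (k (z s) a) + C\<^sup>2 * (t - s) * norm a)"
        by (simp add: algebra_simps power2_eq_square)
      finally have "inner a (f t - f s) \<le> (t - T) * (norm (k (z s) a) + C\<^sup>2 * (t - s) * norm a)
          + (T - s) * (norm (k (z s) a) + C\<^sup>2 * (T - s) * norm a)"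
        unfolding split inner_add_right using 2 4 by linarith
      also have "\<dots> \<le> (t - T) * (norm (k (z s) a) + C\<^sup>2 * (t - s) * norm a)
          + (T - s) * (norm (k (z s) a) + C\<^sup>2 * (t - s) * norm a)"
        using \<open>T < t\<close> \<open>s \<le> T\<close> by (intro add_left_mono mult_left_mono mult_right_mono) auto
      also have "\<dots> = (t - s) * (norm (k (f s) a) + C\<^sup>2 * (t - s) * norm a)"
        by (simp add: f algebra_simps)
      finally show ?thesis using n by blast
    qed
    then show "norm (f t - f s) \<le> C * (t - s)"
      "inner a (f t - f s) \<le> (t - s) * (norm (k (f s) a) + C\<^sup>2 * (t - s) * norm a)" by auto
  qed (use TS in simp)
  moreover have "f 0 = x" "f (T + S) = w" using z z' TS by (auto simp: f_def)
  ultimately show ?thesis unfolding reach_def by blast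
qed

lemma reach_refl: "reach 0 x x"
  unfolding reach_def upath_def by (intro exI[of _ "\<lambda>_. x"]) (use C_pos in auto)

text \<open>The straight segment is run at constant velocity. The factor after
  \<open>norm (lift x (y - x))\<close> slows it down enough to offset the variation of the metric
  along it, so the excess duration is of second order.\<close>

lemma reach_segment:
  assumes M: "coercive R M" and "norm x \<le> R" and "norm y \<le> R"
  shows "reach (norm (lift x (y - x)) * (1 + C * M * norm (y - x))) x y"
proof (cases "y = x")
  case True
  then show ?thesis by (simp add: lift_0 reach_refl)
next
  case False
  define h where "h = y - x"
  define T where "T = norm (lift x h) * (1 + C * M * norm h)"
  have Mp: "M > 0" using M by (simp add: coercive_def)
  have q: "norm (lift x h) > 0" using False lift_eq_0_iff by (simp add: h_def)
  have "norm (lift x h) * 1 \<le> T" unfolding T_def using Mp C_pos by (intro mult_left_mono) auto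
  then have qT: "norm (lift x h) \<le> T" by simp
  then have T: "T > 0" using q by linarith
  have hT: "norm h \<le> C * T"
    by (rule order_trans[OF norm_le_lift[of h x]]) (use qT C_pos in simp)
  define z where "z t = x + (t / T) *\<^sub>R h" for t
  have zz: "z t - z s = ((t - s) / T) *\<^sub>R h" for s t
    by (simp add: z_def diff_divide_distrib scaleR_diff_left)
  have "upath T z"
    unfolding upath_def
  proof (intro conjI allI impI)
    fix s t a assume st: "0 \<le> s \<and> s \<le> t \<and> t \<le> T"
    have "norm (z t - z s) = ((t - s) / T) * norm h" using st T by (simp add: zz)
    also have "\<dots> \<le> ((t - s) / T) * (C * T)" using st T hT by (intro mult_left_mono) auto
    finally show "norm (z t - z s) \<le> C * (t - s)" using T by (simp add: ac_simps)
    have u: "0 \<le> s / T" "s / T \<le> 1" using st T by auto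
    have "z s = (1 - s / T) *\<^sub>R x + (s / T) *\<^sub>R y" by (simp add: z_def h_def algebra_simps)
    \<comment> \<open>Convexity keeps the segment in the ball where \<open>M\<close> is
      valid.\<close>
    then have "z s \<in> cball 0 R"
      using convexD[OF convex_cball[of 0 R], of x y "1 - s / T" "s / T"] u assms by auto
    then have zR: "norm (z s) \<le> R" by simp
    have "norm (x - z s) = s / T * norm h" using st T by (simp add: z_def)
    also have "\<dots> \<le> 1 * norm h" using u by (intro mult_right_mono) auto
    finally have xz: "norm (x - z s) \<le> norm h" by simp
    have "norm (lift (z s) h) \<le> norm (lift x h) * (1 + C * M * norm (x - z s))"
      by (rule norm_lift_change[OF M zR])
    also have "\<dots> \<le> T" unfolding T_def using xz Mp C_pos by (intro mult_left_mono add_left_mono) auto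
    finally have qs: "norm (lift (z s) h) \<le> T" .
    have "inner a h = inner (k (z s) a) (lift (z s) h)" by (simp add: inner_lift)
    also have "\<dots> \<le> norm (k (z s) a) * norm (lift (z s) h)" by (rule norm_cauchy_schwarz)
    also have "\<dots> \<le> norm (k (z s) a) * T" using qs by (intro mult_left_mono) auto
    finally have "inner a (z t - z s) \<le> ((t - s) / T) * (norm (k (z s) a) * T)"
      unfolding zz inner_scaleR_right using st T by (intro mult_left_mono) auto
    also have "\<dots> = (t - s) * norm (k (z s) a)" using T by simp
    also have "\<dots> \<le> (t - s) * (norm (k (z s) a) + C\<^sup>2 * (t - s) * norm a)"
      using st by (intro mult_left_mono) auto
    finally show "inner a (z t - z s) \<le> (t - s) * (norm (k (z s) a) + C\<^sup>2 * (t - s) * norm a)" .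
  qed (use T in simp)
  moreover have "z 0 = x" "z T = y" using T by (auto simp: z_def h_def)
  ultimately show ?thesis unfolding reach_def T_def h_def by blast
qed

text \<open>The comparison opposite to \<open>reach_segment\<close>: the dual inequality of
  \<open>upath\<close> becomes a norm bound by coercivity. Together they determine the lifted
  increments of a path of least duration up to second order.\<close>

lemma upath_lift_le:
  assumes z: "upath T z" and "0 \<le> s" "s \<le> t" "t \<le> T" and M: "coercive R M" "norm (z s) \<le> R"
  shows "norm (lift (z s) (z t - z s)) \<le> (t - s) * (1 + C\<^sup>2 * M * (t - s))"
proof -
  have "norm (lift (z s) (z t - z s)) \<le> (t - s) + ((t - s) * (C\<^sup>2 * (t - s))) * M"
  proof (rule norm_lift_le)
    show "inner a (z t - z s) \<le> (t - s) * norm (k (z s) a) + (t - s) * (C\<^sup>2 * (t - s)) * norm a" for a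
      using upathD(2)[OF assms(1-4), of a] by (simp add: algebra_simps)
  qed (use assms in \<open>auto simp: coercive_def\<close>)
  then show ?thesis by (simp add: algebra_simps)
qed

section \<open>Existence of a path of least duration\<close>

lemma reach_exists: "\<exists>T. reach T x y"
proof -
  obtain M where "coercive (max (norm x) (norm y)) M" using coercive_exists by blast
  from reach_segment[OF this, of x y] show ?thesis by auto
qed

lemma reach_min: "\<exists>T. reach T x y \<and> (\<forall>S. reach S x y \<longrightarrow> T \<le> S)"
proof -
  define D where "D = Inf {T. reach T x y}"
  have ne: "{T. reach T x y} \<noteq> {}" using reach_exists by auto
  have bdd: "bdd_below {T. reach T x y}" using reach_nonneg by (intro bdd_belowI[of _ 0]) auto
  have D: "D \<le> S" if "reach S x y" for S unfolding D_def using bdd that by (intro cInf_lower) auto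
  have D0: "D \<ge> 0" unfolding D_def using ne reach_nonneg by (intro cInf_greatest) auto
  have "\<exists>T z. T < D + 1 / real (Suc n) \<and> upath T z \<and> z 0 = x \<and> z T = y" for n
  proof -
    have "D < D + 1 / real (Suc n)" by simp
    then obtain T where "reach T x y" "T < D + 1 / real (Suc n)"
      using cInf_lessD[OF ne, of "D + 1 / real (Suc n)"] by (auto simp: D_def[symmetric])
    then show ?thesis unfolding reach_def by blast
  qed
  then obtain T z where T: "\<And>n. T n < D + 1 / real (Suc n)" and z: "\<And>n. upath (T n) (z n)"
    and z0: "\<And>n. z n 0 = x" and zT: "\<And>n. z n (T n) = y" by metis
  have TD: "D \<le> T n" for n using D z z0 zT unfolding reach_def by blast
  \<comment> \<open>The paths of the minimizing sequence have different durations; each is frozen at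
    its endpoint so that all live on the common interval \<open>{0..D+1}\<close>.\<close>
  define w where "w n t = z n (min t (T n))" for n t
  have w_lip: "norm (w n t - w n s) \<le> C * \<bar>t - s\<bar>" if "0 \<le> s" "0 \<le> t" for n s t
  proof -
    have *: "norm (w n t - w n s) \<le> C * (t - s)" if "0 \<le> s" "s \<le> t" for s t
    proof -
      have "norm (w n t - w n s) \<le> C * (min t (T n) - min s (T n))"
        unfolding w_def using that TD[of n] D0 by (intro upathD(1)[OF z]) auto
      also have "\<dots> \<le> C * (t - s)" using C_pos that by (intro mult_left_mono) auto
      finally show ?thesis .
    qed
    show ?thesis
    proof (cases "s \<le> t")
      case True then show ?thesis using *[of s t] that by simp
    next
      case False then show ?thesis using *[of t s] that by (simp add: norm_minus_commute)
    qed
  qed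
  obtain g r where g: "continuous_on {0..D+1} g" "strict_mono (r :: nat \<Rightarrow> nat)"
    and conv: "\<And>e. 0 < e \<Longrightarrow> \<exists>N. \<forall>n x. n \<ge> N \<and> x \<in> {0..D+1} \<longrightarrow> norm (w (r n) x - g x) < e"
  proof (rule Arzela_Ascoli[of "{0..D+1}" w "norm x + C * (D + 1)"])
    show "norm (w n t) \<le> norm x + C * (D + 1)" if "t \<in> {0..D+1}" for n t
    proof -
      have "w n 0 = x" using TD[of n] D0 z0 by (simp add: w_def)
      then have "norm (w n t - x) \<le> C * t" using w_lip[of 0 t n] that by simp
      also have "\<dots> \<le> C * (D + 1)" using that C_pos by (intro mult_left_mono) auto
      finally show ?thesis using norm_triangle_sub[of "w n t" x] by simp
    qed
    show "\<exists>d>0. \<forall>n s. s \<in> {0..D+1} \<and> norm (t - s) < d \<longrightarrow> norm (w n t - w n s) < e"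
      if t: "t \<in> {0..D+1}" and e: "0 < e" for t e
    proof (intro exI[of _ "e / C"] conjI allI impI)
      fix n s assume s: "s \<in> {0..D+1} \<and> norm (t - s) < e / C"
      have "norm (w n t - w n s) \<le> C * \<bar>t - s\<bar>" using w_lip[of s t n] s t by simp
      also have "\<dots> < e" using s C_pos by (simp add: pos_less_divide_eq mult.commute)
      finally show "norm (w n t - w n s) < e" .
    qed (use e C_pos in simp)
  qed auto
  have lim: "(\<lambda>n. w (r n) t) \<longlonglongrightarrow> g t" if "t \<in> {0..D+1}" for t
    unfolding LIMSEQ_iff using conv that by blast
  have up: "upath D g"
    unfolding upath_def
  proof (intro conjI allI impI D0)
    fix s t a assume st: "0 \<le> s \<and> s \<le> t \<and> t \<le> D"
    have ls: "(\<lambda>n. w (r n) s) \<longlonglongrightarrow> g s" and lt: "(\<lambda>n. w (r n) t) \<longlonglongrightarrow> g t"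
      using st by (auto intro!: lim)
    \<comment> \<open>Up to \<open>D\<close> no path is frozen yet, so the inequalities of
      \<open>upath\<close> hold there and pass to the limit.\<close>
    have w: "w n s = z n s" "w n t = z n t" "t \<le> T n" for n using st TD[of n] by (auto simp: w_def)
    have diff: "(\<lambda>n. w (r n) t - w (r n) s) \<longlonglongrightarrow> g t - g s" by (intro tendsto_diff lt ls)
    have "norm (w (r n) t - w (r n) s) \<le> C * (t - s)" for n
      using upathD(1)[OF z, of s t "r n"] st w by simp
    then show "norm (g t - g s) \<le> C * (t - s)"
      using tendsto_norm[OF diff] by (intro LIMSEQ_le_const2) auto
    have kl: "(\<lambda>n. k (w (r n) s) a) \<longlonglongrightarrow> k (g s) a"
      using continuous_on_k[of UNIV "\<lambda>x. x" "\<lambda>_. a"] ls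
      by (auto intro!: continuous_on_tendsto_compose[of UNIV "\<lambda>x. k x a"])
    have "(\<lambda>n. (t - s) * (norm (k (w (r n) s) a) + C\<^sup>2 * (t - s) * norm a))
        \<longlonglongrightarrow> (t - s) * (norm (k (g s) a) + C\<^sup>2 * (t - s) * norm a)"
      by (intro tendsto_intros kl)
    moreover have "inner a (w (r n) t - w (r n) s) \<le> (t - s) * (norm (k (w (r n) s) a) + C\<^sup>2 * (t - s) * norm a)" for n
      using upathD(2)[OF z, of s t "r n" a] st w by simp
    ultimately show "inner a (g t - g s) \<le> (t - s) * (norm (k (g s) a) + C\<^sup>2 * (t - s) * norm a)"
      using tendsto_inner[OF tendsto_const[of a] diff] by (intro LIMSEQ_le) auto
  qed
  have "(\<lambda>n. w (r n) 0) \<longlonglongrightarrow> x"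
    using order_trans[OF D0 TD] z0 by (simp add: w_def)
  then have g0: "g 0 = x" using lim[of 0] D0 LIMSEQ_unique by fastforce
  \<comment> \<open>At time \<open>D\<close> each path is at most \<open>C * (T n - D)\<close> away
    from its endpoint \<open>y\<close>.\<close>
  have "(\<lambda>n. w n D) \<longlonglongrightarrow> y"
  proof (rule LIM_zero_cancel, rule Lim_null_comparison)
    have "norm (w n D - y) \<le> C * (1 / real (Suc n))" for n
    proof -
      have "norm (w n D - y) = norm (z n (T n) - z n D)"
        using TD[of n] zT by (simp add: w_def norm_minus_commute min_def)
      also have "\<dots> \<le> C * (T n - D)" using TD[of n] D0 by (intro upathD(1)[OF z]) auto
      also have "\<dots> \<le> C * (1 / real (Suc n))" using T[of n] C_pos by (intro mult_left_mono) auto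
      finally show ?thesis .
    qed
    then show "eventually (\<lambda>n. norm (w n D - y) \<le> C * inverse (real (Suc n))) sequentially"
      by (intro always_eventually allI) (simp add: divide_inverse)
    show "(\<lambda>n. C * inverse (real (Suc n))) \<longlonglongrightarrow> 0"
      using tendsto_mult[OF tendsto_const LIMSEQ_inverse_real_of_nat, of C] by simp
  qed
  then have "(\<lambda>n. w (r n) D) \<longlonglongrightarrow> y"
    using LIMSEQ_subseq_LIMSEQ[OF _ g(2)] by (fastforce simp: o_def)
  then have "g D = y" using lim[of D] D0 LIMSEQ_unique by fastforce
  then have "reach D x y" using up g0 unfolding reach_def by blast
  then show ?thesis using D by blast
qed

text \<open>The parallelogram law in \<open>'v\<close> turns almost additivity of lengths into a bound on
  second differences.\<close>

lemma minimal_second_difference: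
  assumes z: "upath T z" and min: "\<And>S. reach S (z 0) (z T) \<Longrightarrow> T \<le> S"
  obtains A where "\<And>s t. 0 \<le> s \<Longrightarrow> s < t \<Longrightarrow> t \<le> T \<Longrightarrow>
      norm (z s - 2 *\<^sub>R z ((s + t) / 2) + z t) \<le> A * (t - s) * sqrt (t - s)"
    and "\<And>s t. 0 \<le> s \<Longrightarrow> s < t \<Longrightarrow> t \<le> T \<Longrightarrow>
      (t - s) / (1 + A * (t - s)) \<le> norm (lift (z s) (z t - z s)) \<and>
      norm (lift (z s) (z t - z s)) \<le> (t - s) * (1 + A * (t - s))"
proof -
  define R where "R = norm (z 0) + C * T"
  obtain M where M: "coercive R M" using coercive_exists by blast
  then have Mp: "M > 0" by (simp add: coercive_def)
  define \<kappa> where "\<kappa> = C\<^sup>2 * M"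
  have kp: "\<kappa> > 0" using Mp C_pos by (simp add: \<kappa>_def)
  have zR: "norm (z s) \<le> R" if "0 \<le> s" "s \<le> T" for s
  proof -
    have "norm (z s - z 0) \<le> C * (s - 0)" using upathD(1)[OF z, of 0 s] that by simp
    also have "\<dots> \<le> C * T" using that C_pos by (intro mult_left_mono) auto
    finally show ?thesis using norm_triangle_sub[of "z s" "z 0"] by (simp add: R_def)
  qed
  \<comment> \<open>A faster connection between two intermediate points could be spliced in,
    contradicting minimality of the whole path.\<close>
  have sub: "t - s \<le> S" if "0 \<le> s" "s \<le> t" "t \<le> T" "reach S (z s) (z t)" for s t S
  proof -
    have "reach (s - 0) (z 0) (z s)" "reach (T - t) (z t) (z T)"
      using that upath_reach[OF z, of 0 s] upath_reach[OF z, of t T] by auto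
    then have "reach ((s - 0) + S + (T - t)) (z 0) (z T)"
      using that(4) reach_trans by blast
    from min[OF this] show ?thesis by simp
  qed
  have upper: "norm (lift (z s) (z t - z s)) \<le> (t - s) * (1 + \<kappa> * (t - s))" if "0 \<le> s" "s \<le> t" "t \<le> T" for s t
    using upath_lift_le[OF z that M] zR that by (simp add: \<kappa>_def)
  have lower: "t - s \<le> norm (lift (z s) (z t - z s)) * (1 + \<kappa> * (t - s))" if "0 \<le> s" "s \<le> t" "t \<le> T" for s t
  proof -
    have "t - s \<le> norm (lift (z s) (z t - z s)) * (1 + C * M * norm (z t - z s))"
      using that by (intro sub reach_segment[OF M] zR) auto
    also have "\<dots> \<le> norm (lift (z s) (z t - z s)) * (1 + C * M * (C * (t - s)))"
      using upathD(1)[OF z that] C_pos Mp by (intro mult_left_mono add_left_mono) auto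
    finally show ?thesis by (simp add: \<kappa>_def power2_eq_square ac_simps)
  qed
  define E where "E = \<kappa> * T"
  \<comment> \<open>This is ((1 + e)^4 - (1 - 2 e)) / e evaluated at the largest possible
    \<open>e\<close>, namely \<open>E\<close>.\<close>
  define P where "P = 6 + 6 * E + 4 * E\<^sup>2 + E ^ 3"
  have T0: "T \<ge> 0" using z by (simp add: upath_def)
  then have E0: "E \<ge> 0" using kp by (simp add: E_def)
  have P0: "P \<ge> 0" using E0 by (simp add: P_def)
  define A where "A = C * sqrt (\<kappa> * P)"
  have mid: "norm (z s - 2 *\<^sub>R z ((s + t) / 2) + z t) \<le> A * (t - s) * sqrt (t - s)"
    if st: "0 \<le> s" "s < t" "t \<le> T" for s t
  proof -
    define m where "m = (s + t) / 2"
    define d where "d = t - s"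
    define e where "e = \<kappa> * d"
    have m: "m - s = d / 2" "t - m = d / 2" "s \<le> m" "m \<le> t" using st by (auto simp: m_def d_def field_simps)
    have d: "d > 0" using st by (simp add: d_def)
    have e0: "e > 0" using kp d by (simp add: e_def)
    have eE: "e \<le> E" unfolding e_def E_def using st kp by (intro mult_left_mono) (auto simp: d_def)
    define u where "u = lift (z s) (z m - z s)"
    \<comment> \<open>Both increments are lifted at \<open>z s\<close>, so that their lifts add up
      to the lift of the full increment; the change of base point from \<open>z m\<close> costs
      \<open>v\<close> a second factor \<open>1 + e\<close>.\<close>
    define v where "v = lift (z s) (z t - z m)"
    have half: "(d / 2) * (1 + \<kappa> * (d / 2)) \<le> (d / 2) * (1 + e)"
      using d kp by (intro mult_left_mono) (auto simp: e_def)
    have u: "norm u \<le> (d / 2) * (1 + e)"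
      using order_trans[OF upper[of s m, unfolded m(1)] half] st m unfolding u_def by simp
    have "norm v \<le> norm (lift (z m) (z t - z m)) * (1 + C * M * norm (z m - z s))"
      unfolding v_def using st m by (intro norm_lift_change[OF M] zR) auto
    also have "\<dots> \<le> ((d / 2) * (1 + e)) * (1 + e)"
    proof (intro mult_mono add_left_mono)
      show "norm (lift (z m) (z t - z m)) \<le> d / 2 * (1 + e)"
        using order_trans[OF upper[of m t, unfolded m(2)] half] st m by simp
      have "C * M * norm (z m - z s) \<le> C * M * (C * d)"
      proof (intro mult_left_mono)
        have "norm (z m - z s) \<le> C * (m - s)" using st m by (intro upathD(1)[OF z]) auto
        also have "\<dots> \<le> C * d" using m d C_pos by simp
        finally show "norm (z m - z s) \<le> C * d" .
      qed (use C_pos Mp in auto)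
      then show "C * M * norm (z m - z s) \<le> e" by (simp add: e_def \<kappa>_def power2_eq_square ac_simps)
    qed (use d e0 C_pos Mp in auto)
    finally have v: "norm v \<le> (d / 2) * (1 + e)\<^sup>2" by (simp add: power2_eq_square)
    have "u + v = lift (z s) (z t - z s)" unfolding u_def v_def lift_add[symmetric] by simp
    then have "d \<le> norm (u + v) * (1 + e)" using lower[of s t] st by (simp add: d_def e_def)
    then have "d\<^sup>2 \<le> (norm (u + v))\<^sup>2 * (1 + e)\<^sup>2"
      using power_mono[of d "norm (u + v) * (1 + e)" 2] d by (simp add: power_mult_distrib)
    \<comment> \<open>A polynomial lower bound for 1 / (1 + e)^2, chosen so that the leading terms
      cancel below.\<close>
    moreover have "(1 - 2 * e) * (1 + e)\<^sup>2 \<le> 1"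
    proof -
      have "(1 - 2 * e) * (1 + e)\<^sup>2 = 1 - e\<^sup>2 * (3 + 2 * e)" by (simp add: algebra_simps power2_eq_square)
      then show ?thesis using e0 by simp
    qed
    then have "d\<^sup>2 * ((1 - 2 * e) * (1 + e)\<^sup>2) \<le> d\<^sup>2 * 1" by (intro mult_left_mono) auto
    ultimately have "(d\<^sup>2 * (1 - 2 * e)) * (1 + e)\<^sup>2 \<le> (norm (u + v))\<^sup>2 * (1 + e)\<^sup>2"
      by (simp only: mult.assoc mult_1_right)
    moreover have "(1 + e)\<^sup>2 > 0" using e0 by simp
    ultimately have uv: "d\<^sup>2 * (1 - 2 * e) \<le> (norm (u + v))\<^sup>2" by (simp only: mult_le_cancel_right_pos)
    have "(norm u)\<^sup>2 \<le> ((d / 2) * (1 + e))\<^sup>2" using u by (intro power_mono) auto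
    moreover have "\<dots> \<le> ((d / 2) * (1 + e)\<^sup>2)\<^sup>2"
      using d e0 by (intro power_mono mult_left_mono) (auto simp: power2_eq_square algebra_simps)
    moreover have "(norm v)\<^sup>2 \<le> ((d / 2) * (1 + e)\<^sup>2)\<^sup>2" using v by (intro power_mono) auto
    moreover have "((d / 2) * (1 + e)\<^sup>2)\<^sup>2 = d\<^sup>2 / 4 * (1 + e) ^ 4"
      by (simp add: power_mult_distrib power_divide power_mult[symmetric])
    \<comment> \<open>The parallelogram law: two vectors of norm about \<open>d / 2\<close> with a
      sum of norm about \<open>d\<close> must be nearly equal.\<close>
    moreover have "(norm (u - v))\<^sup>2 = 2 * (norm u)\<^sup>2 + 2 * (norm v)\<^sup>2 - (norm (u + v))\<^sup>2"
      by (simp add: power2_norm_eq_inner inner_add_left inner_add_right inner_diff_left inner_diff_right)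
    ultimately have "(norm (u - v))\<^sup>2 \<le> d\<^sup>2 * (1 + e) ^ 4 - d\<^sup>2 * (1 - 2 * e)" using uv by linarith
    also have "\<dots> = d\<^sup>2 * (e * (6 + 6 * e + 4 * e\<^sup>2 + e ^ 3))"
      by (simp add: algebra_simps power2_eq_square power3_eq_cube power4_eq_xxxx)
    also have "\<dots> \<le> d\<^sup>2 * (e * P)"
      unfolding P_def using eE e0 by (intro mult_left_mono add_mono power_mono) auto
    also have "\<dots> = \<kappa> * P * d * d\<^sup>2" by (simp add: e_def)
    finally have "norm (u - v) \<le> sqrt (\<kappa> * P * d * d\<^sup>2)" by (intro real_le_rsqrt)
    also have "\<dots> = sqrt (\<kappa> * P) * sqrt d * d" using d by (simp add: real_sqrt_mult)
    finally have uv2: "norm (u - v) \<le> sqrt (\<kappa> * P) * sqrt d * d" .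
    have "u - v = lift (z s) ((z m - z s) - (z t - z m))" unfolding u_def v_def lift_diff[symmetric] ..
    then have "norm ((z m - z s) - (z t - z m)) \<le> C * (sqrt (\<kappa> * P) * sqrt d * d)"
      using norm_le_lift[of "(z m - z s) - (z t - z m)" "z s"] uv2 C_pos
      by (metis mult_left_mono order_trans less_imp_le)
    moreover have "(z m - z s) - (z t - z m) = - (z s - 2 *\<^sub>R z m + z t)" by (simp add: scaleR_2)
    ultimately have "norm (z s - 2 *\<^sub>R z m + z t) \<le> C * (sqrt (\<kappa> * P) * sqrt d * d)"
      by (simp only: norm_minus_cancel)
    then show ?thesis by (simp add: A_def d_def m_def ac_simps)
  qed
  define B where "B = max A \<kappa>"
  have Bp: "B > 0" using kp by (simp add: B_def)
  show ?thesis
  proof (rule that[of B])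
    fix s t :: real assume st: "0 \<le> s" "s < t" "t \<le> T"
    have "A * (t - s) * sqrt (t - s) \<le> B * (t - s) * sqrt (t - s)"
      using st by (intro mult_right_mono) (auto simp: B_def)
    then show "norm (z s - 2 *\<^sub>R z ((s + t) / 2) + z t) \<le> B * (t - s) * sqrt (t - s)"
      using mid[OF st] by linarith
    have kB: "1 + \<kappa> * (t - s) \<le> 1 + B * (t - s)"
      using st by (intro add_left_mono mult_right_mono) (auto simp: B_def)
    have "t - s \<le> norm (lift (z s) (z t - z s)) * (1 + \<kappa> * (t - s))" using lower st by simp
    also have "\<dots> \<le> norm (lift (z s) (z t - z s)) * (1 + B * (t - s))"
      using kB by (intro mult_left_mono) auto
    finally have lo: "(t - s) / (1 + B * (t - s)) \<le> norm (lift (z s) (z t - z s))"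
      using st Bp by (subst pos_divide_le_eq) (auto intro: add_pos_nonneg)
    have "norm (lift (z s) (z t - z s)) \<le> (t - s) * (1 + \<kappa> * (t - s))" using upper st by simp
    also have "\<dots> \<le> (t - s) * (1 + B * (t - s))" using kB st by (intro mult_left_mono) auto
    finally show "(t - s) / (1 + B * (t - s)) \<le> norm (lift (z s) (z t - z s)) \<and>
      norm (lift (z s) (z t - z s)) \<le> (t - s) * (1 + B * (t - s))" using lo by blast
  qed
qed

text \<open>The second differences give the derivative by \<open>zygmund_C1\<close>; dividing the
  two-sided length bounds by \<open>t - s\<close> and letting \<open>t\<close> decrease to
  \<open>s\<close> gives its norm.\<close>

lemma minimal_upath_C1:
  assumes z: "upath T z" and min: "\<And>S. reach S (z 0) (z T) \<Longrightarrow> T \<le> S" and T: "T > 0"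
  shows "\<exists>u. continuous_on {0..T} u \<and>
    (\<forall>t\<in>{0..T}. (z has_vector_derivative u t) (at t within {0..T}) \<and> norm (lift (z t) (u t)) = 1)"
proof -
  obtain A where mid: "\<And>s t. 0 \<le> s \<Longrightarrow> s < t \<Longrightarrow> t \<le> T \<Longrightarrow>
      norm (z s - 2 *\<^sub>R z ((s + t) / 2) + z t) \<le> A * (t - s) * sqrt (t - s)"
    and len: "\<And>s t. 0 \<le> s \<Longrightarrow> s < t \<Longrightarrow> t \<le> T \<Longrightarrow>
      (t - s) / (1 + A * (t - s)) \<le> norm (lift (z s) (z t - z s)) \<and>
      norm (lift (z s) (z t - z s)) \<le> (t - s) * (1 + A * (t - s))"
    using minimal_second_difference[OF z min] by metis
  obtain u where u: "continuous_on {0..T} u" and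
    der: "\<And>t. t \<in> {0..T} \<Longrightarrow> (z has_vector_derivative u t) (at t within {0..T})"
    using zygmund_C1[of T z C A, OF upathD(1)[OF z] mid] by auto
  have cz: "continuous_on {0..T} z"
    using der has_vector_derivative_continuous by (fastforce simp: continuous_on_eq_continuous_within)
  have one: "norm (lift (z s) (u s)) = 1" if s: "s \<in> {0..<T}" for s
  proof -
    define p where "p n = s + (T - s) * inverse (real (Suc n))" for n
    have p: "s < p n" "p n \<le> T" for n
    proof -
      show "s < p n" using s by (simp add: p_def)
      have "(T - s) * inverse (real (Suc n)) \<le> (T - s) * 1"
        using s by (intro mult_left_mono) (auto simp: inverse_le_1_iff)
      then show "p n \<le> T" by (simp add: p_def)
    qed
    have "(\<lambda>n. s + (T - s) * inverse (real (Suc n))) \<longlonglongrightarrow> s + (T - s) * 0"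
      by (intro tendsto_intros LIMSEQ_inverse_real_of_nat)
    then have pl: "p \<longlonglongrightarrow> s" by (simp add: p_def[abs_def])
    have "filterlim p (at s within {0..T}) sequentially"
    proof (unfold filterlim_at, intro conjI always_eventually allI pl)
      show "p n \<in> {0..T}" "p n \<noteq> s" for n using p[of n] s by auto
    qed
    moreover have "((\<lambda>t. (1 / norm (t - s)) *\<^sub>R (z t - (z s + (t - s) *\<^sub>R u s))) \<longlongrightarrow> 0) (at s within {0..T})"
      using der[of s] s by (simp add: has_vector_derivative_def has_derivative_within)
    ultimately have "(\<lambda>n. (1 / norm (p n - s)) *\<^sub>R (z (p n) - (z s + (p n - s) *\<^sub>R u s))) \<longlonglongrightarrow> 0"
      by (rule filterlim_compose[rotated])
    moreover have "(1 / norm (p n - s)) *\<^sub>R (z (p n) - (z s + (p n - s) *\<^sub>R u s)) = (1 / (p n - s)) *\<^sub>R (z (p n) - z s) - u s" for n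
      using scaleR_diff_right[of "1 / (p n - s)" "z (p n) - z s" "(p n - s) *\<^sub>R u s"] p(1)[of n]
      by (simp add: diff_diff_eq)
    ultimately have "(\<lambda>n. (1 / (p n - s)) *\<^sub>R (z (p n) - z s)) \<longlonglongrightarrow> u s"
      by (simp only: LIM_zero_cancel)
    then have "(\<lambda>n. lift (z s) ((1 / (p n - s)) *\<^sub>R (z (p n) - z s))) \<longlonglongrightarrow> lift (z s) (u s)"
      using continuous_on_lift[of UNIV "\<lambda>_. z s" "\<lambda>x. x"]
      by (auto intro!: continuous_on_tendsto_compose[of UNIV "lift (z s)"])
    then have l: "(\<lambda>n. norm (lift (z s) (z (p n) - z s)) / (p n - s)) \<longlonglongrightarrow> norm (lift (z s) (u s))"
      using tendsto_norm p by (fastforce simp: lift_scale less_imp_le)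
    have "(\<lambda>n. 1 + A * (p n - s)) \<longlonglongrightarrow> 1 + A * (s - s)" by (intro tendsto_intros pl)
    then have up: "(\<lambda>n. 1 + A * (p n - s)) \<longlonglongrightarrow> 1" by simp
    have lo: "(\<lambda>n. 1 / (1 + A * (p n - s))) \<longlonglongrightarrow> 1"
      using tendsto_divide[OF tendsto_const[of 1] up] by simp
    have bd: "1 / (1 + A * (p n - s)) \<le> norm (lift (z s) (z (p n) - z s)) / (p n - s)"
        "norm (lift (z s) (z (p n) - z s)) / (p n - s) \<le> 1 + A * (p n - s)" for n
    proof -
      have l: "(p n - s) / (1 + A * (p n - s)) \<le> norm (lift (z s) (z (p n) - z s))"
        "norm (lift (z s) (z (p n) - z s)) \<le> (p n - s) * (1 + A * (p n - s))"
        using len[of s "p n"] p[of n] s by auto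
      show "norm (lift (z s) (z (p n) - z s)) / (p n - s) \<le> 1 + A * (p n - s)"
        using l(2) p(1)[of n] by (simp add: pos_divide_le_eq mult.commute)
      have "1 / (1 + A * (p n - s)) = ((p n - s) / (1 + A * (p n - s))) / (p n - s)"
        using p(1)[of n] by simp
      also have "\<dots> \<le> norm (lift (z s) (z (p n) - z s)) / (p n - s)"
        using l(1) p(1)[of n] by (intro divide_right_mono) auto
      finally show "1 / (1 + A * (p n - s)) \<le> norm (lift (z s) (z (p n) - z s)) / (p n - s)" .
    qed
    have "norm (lift (z s) (u s)) \<le> 1" using bd(2) by (intro LIMSEQ_le[OF l up]) auto
    moreover have "1 \<le> norm (lift (z s) (u s))" using bd(1) by (intro LIMSEQ_le[OF lo l]) auto
    ultimately show ?thesis by simp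
  qed
  \<comment> \<open>At the right end there are no later points to approach from, so the value 1 is
    extended by continuity.\<close>
  have "norm (lift (z t) (u t)) = 1" if "t \<in> {0..T}" for t
  proof (rule continuous_constant_on_closure[of "{0..<T}" "\<lambda>t. norm (lift (z t) (u t))" 1])
    show "continuous_on (closure {0..<T}) (\<lambda>t. norm (lift (z t) (u t)))"
      using T by (auto intro!: continuous_on_norm continuous_on_lift u cz)
  qed (use one that T in auto)
  with u der show ?thesis by blast
qed

end

subsection \<open>Controlled paths and geodesics\<close>

text \<open>A Gronwall inequality free of derivatives. While \<open>l\<close> grows by at most 1/2,
  the maximum of \<open>w\<close> is at most twice its initial value; the intermediate value theorem
  cuts the interval into \<open>n\<close> such stretches.\<close>

lemma gronwall_doubling:
  fixes w l :: "real \<Rightarrow> real"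
  assumes w: "continuous_on {0..1} w" and l: "continuous_on {0..1} l"
    and mono: "\<And>a b. 0 \<le> a \<Longrightarrow> a \<le> b \<Longrightarrow> b \<le> 1 \<Longrightarrow> l a \<le> l b"
    and step: "\<And>a b W. 0 \<le> a \<Longrightarrow> a \<le> b \<Longrightarrow> b \<le> 1 \<Longrightarrow> (\<And>s. s \<in> {a..b} \<Longrightarrow> w s \<le> W) \<Longrightarrow>
      w b \<le> w a + (l b - l a) * W"
    and pos: "\<And>t. w t \<ge> 0"
    and ab: "0 \<le> a" "a \<le> b" "b \<le> 1" "l b - l a \<le> real n / 2"
  shows "w b \<le> 2 ^ n * w a"
proof -
  have base: "w b \<le> 2 * w a" if ab: "0 \<le> a" "a \<le> b" "b \<le> 1" "l b - l a \<le> 1 / 2" for a b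
  proof -
    have "continuous_on {a..b} w" by (rule continuous_on_subset[OF w]) (use ab in auto)
    then obtain m where m: "m \<in> {a..b}" "\<And>s. s \<in> {a..b} \<Longrightarrow> w s \<le> w m"
      using continuous_attains_sup[of "{a..b}" w] ab by auto
    have "w m \<le> w a + (l m - l a) * w m" using m ab by (intro step) auto
    moreover have "l m - l a \<le> 1 / 2" using mono[of m b] m ab by auto
    then have "(l m - l a) * w m \<le> 1 / 2 * w m" using pos by (intro mult_right_mono)
    ultimately have "w m \<le> 2 * w a" by linarith
    then show ?thesis using m(2)[of b] ab by simp
  qed
  show ?thesis
    using ab
  proof (induction n arbitrary: a)
    case 0
    then have ll: "l b = l a" using mono[of a b] by simp
    have "w b \<le> w a + (l b - l a) * W" if "\<And>s. s \<in> {a..b} \<Longrightarrow> w s \<le> W" for W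
      using 0 that by (intro step) auto
    moreover have "continuous_on {a..b} w" by (rule continuous_on_subset[OF w]) (use 0 in auto)
    then obtain m where "m \<in> {a..b}" "\<And>s. s \<in> {a..b} \<Longrightarrow> w s \<le> w m"
      using continuous_attains_sup[of "{a..b}" w] 0 by auto
    ultimately have "w b \<le> w a + (l b - l a) * w m" by blast
    then show ?case using ll by simp
  next
    case (Suc n)
    show ?case
    proof (cases "l b - l a \<le> 1 / 2")
      case True
      have "2 * w a \<le> 2 ^ Suc n * w a" using pos by (intro mult_right_mono) auto
      then show ?thesis using base[of a b] True Suc.prems by linarith
    next
      case False
      have "continuous_on {a..b} l" by (rule continuous_on_subset[OF l]) (use Suc.prems in auto)
      then obtain c where c: "a \<le> c" "c \<le> b" "l c = l a + 1 / 2"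
        using IVT'[of l a "l a + 1 / 2" b] False Suc.prems by auto
      have "w b \<le> 2 ^ n * w c" using c Suc.prems by (intro Suc.IH) (auto simp: field_simps)
      also have "\<dots> \<le> 2 ^ n * (2 * w a)" using base[of a c] c Suc.prems by (intro mult_left_mono) auto
      finally show ?thesis by simp
    qed
  qed
qed

context rkhs_fields
begin

section \<open>Trajectories of a control and their length\<close>

definition ctrl :: "(real \<Rightarrow> 'v) \<Rightarrow> (real \<Rightarrow> real^'n) \<Rightarrow> bool" where
  "ctrl v x \<longleftrightarrow> (\<lambda>t. norm (v t)) integrable_on {0..1} \<and>
     (\<forall>t\<in>{0..1}. ((\<lambda>s. ev (v s) (x s)) has_integral (x t - x 0)) {0..t})"

text \<open>Despite its name this is a length and not an energy: it is the clock in which the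
  trajectory has unit speed.\<close>

definition action :: "(real \<Rightarrow> 'v) \<Rightarrow> real \<Rightarrow> real" where
  "action v t = integral {0..t} (\<lambda>s. norm (v s))"

lemma action_diff:
  assumes "(\<lambda>t. norm (v t)) integrable_on {0..1}" "0 \<le> s" "s \<le> t" "t \<le> 1"
  shows "((\<lambda>s. norm (v s)) has_integral (action v t - action v s)) {s..t}"
proof -
  have i: "(\<lambda>t. norm (v t)) integrable_on {0..t}" "(\<lambda>t. norm (v t)) integrable_on {s..t}"
    using integrable_on_subinterval[OF assms(1)] assms by auto
  have "action v s + integral {s..t} (\<lambda>s. norm (v s)) = action v t"
    unfolding action_def using assms i by (intro Henstock_Kurzweil_Integration.integral_combine) auto
  then show ?thesis using i(2) by (simp add: has_integral_integrable_integral)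
qed

lemma ctrl_diff:
  assumes "ctrl v x" "0 \<le> s" "s \<le> t" "t \<le> 1"
  shows "((\<lambda>s. ev (v s) (x s)) has_integral (x t - x s)) {s..t}"
proof -
  have f: "((\<lambda>s. ev (v s) (x s)) has_integral (x t - x 0)) {0..t}"
      "((\<lambda>s. ev (v s) (x s)) has_integral (x s - x 0)) {0..s}"
    using assms unfolding ctrl_def by auto
  then have i: "(\<lambda>s. ev (v s) (x s)) integrable_on {s..t}"
    using integrable_on_subinterval[of "\<lambda>s. ev (v s) (x s)" "{0..t}" s t] assms by auto
  have "integral {0..s} (\<lambda>s. ev (v s) (x s)) + integral {s..t} (\<lambda>s. ev (v s) (x s)) = integral {0..t} (\<lambda>s. ev (v s) (x s))"
    using assms f(1) by (intro Henstock_Kurzweil_Integration.integral_combine) auto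
  then have "integral {s..t} (\<lambda>s. ev (v s) (x s)) = x t - x s"
    using f[THEN integral_unique] by (simp add: algebra_simps)
  then show ?thesis using i by (simp add: has_integral_integrable_integral)
qed

lemma action_mono:
  assumes "(\<lambda>t. norm (v t)) integrable_on {0..1}" "0 \<le> s" "s \<le> t" "t \<le> 1"
  shows "action v s \<le> action v t"
  using has_integral_nonneg[OF action_diff[OF assms]] by simp

lemma action_continuous:
  "(\<lambda>t. norm (v t)) integrable_on {0..1} \<Longrightarrow> continuous_on {0..1} (action v)"
  unfolding action_def[abs_def] by (rule indefinite_integral_continuous_1)

lemma ctrl_norm:
  assumes c: "ctrl v x" and st: "0 \<le> s" "s \<le> t" "t \<le> 1"
  shows "norm (x t - x s) \<le> C * (action v t - action v s)"
proof -
  have i: "(\<lambda>t. norm (v t)) integrable_on {0..1}" using c by (simp add: ctrl_def)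
  note f = ctrl_diff[OF c st] and g = has_integral_mult_right[OF action_diff[OF i st], of C]
  have "norm (integral {s..t} (\<lambda>s. ev (v s) (x s))) \<le> integral {s..t} (\<lambda>s. C * norm (v s))"
    using f g ev_bound by (intro Henstock_Kurzweil_Integration.integral_norm_bound_integral) auto
  then show ?thesis by (simp only: integral_unique[OF f] integral_unique[OF g])
qed

text \<open>Pairing the velocity with \<open>a\<close> gives
  \<open>inner (k (x \<tau>) a) (v \<tau>)\<close>. Cauchy-Schwarz and a change of base point from
  \<open>x \<tau>\<close> to \<open>x s\<close> leave the inequality of \<open>upath\<close> with
  elapsed length in place of elapsed time.\<close>

lemma ctrl_inner:
  assumes c: "ctrl v x" and st: "0 \<le> s" "s \<le> t" "t \<le> 1"
  shows "inner a (x t - x s) \<le>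
    (action v t - action v s) * (norm (k (x s) a) + C\<^sup>2 * (action v t - action v s) * norm a)"
proof -
  have i: "(\<lambda>t. norm (v t)) integrable_on {0..1}" using c by (simp add: ctrl_def)
  define L where "L = action v t - action v s"
  have f: "((\<lambda>\<tau>. inner a (ev (v \<tau>) (x \<tau>))) has_integral inner a (x t - x s)) {s..t}"
    using has_integral_linear[OF ctrl_diff[OF c st] bounded_linear_inner_right[of a]] by (simp add: o_def)
  have g: "((\<lambda>\<tau>. (norm (k (x s) a) + C\<^sup>2 * L * norm a) * norm (v \<tau>)) has_integral
      (norm (k (x s) a) + C\<^sup>2 * L * norm a) * L) {s..t}"
    unfolding L_def by (rule has_integral_mult_right[OF action_diff[OF i st]])
  have "inner a (x t - x s) \<le> (norm (k (x s) a) + C\<^sup>2 * L * norm a) * L"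
  proof (rule has_integral_le[OF f g])
    fix \<tau> assume \<tau>: "\<tau> \<in> {s..t}"
    have "norm (x s - x \<tau>) \<le> C * (action v \<tau> - action v s)"
      using ctrl_norm[OF c, of s \<tau>] \<tau> st by (simp add: norm_minus_commute)
    also have "\<dots> \<le> C * L" unfolding L_def
      using action_mono[OF i, of \<tau> t] \<tau> st C_pos by (intro mult_left_mono) auto
    finally have "C * norm (x s - x \<tau>) * norm a \<le> C * (C * L) * norm a"
      using C_pos by (intro mult_right_mono mult_left_mono) auto
    then have kk: "norm (k (x \<tau>) a) \<le> norm (k (x s) a) + C\<^sup>2 * L * norm a"
      using norm_k_change[of "x \<tau>" a "x s"] by (simp add: power2_eq_square mult.assoc)
    have "inner a (ev (v \<tau>) (x \<tau>)) = inner (k (x \<tau>) a) (v \<tau>)" by (simp add: k_inner)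
    also have "\<dots> \<le> norm (k (x \<tau>) a) * norm (v \<tau>)" by (rule norm_cauchy_schwarz)
    also have "\<dots> \<le> (norm (k (x s) a) + C\<^sup>2 * L * norm a) * norm (v \<tau>)"
      using kk by (intro mult_right_mono) auto
    finally show "inner a (ev (v \<tau>) (x \<tau>)) \<le> (norm (k (x s) a) + C\<^sup>2 * L * norm a) * norm (v \<tau>)" .
  qed
  then show ?thesis by (simp add: L_def mult.commute)
qed

lemma ctrl_continuous:
  assumes c: "ctrl v x"
  shows "continuous_on {0..1} x"
proof -
  have "(\<lambda>s. ev (v s) (x s)) integrable_on {0..1}" using c by (auto simp: ctrl_def)
  then have "continuous_on {0..1} (\<lambda>t. x 0 + integral {0..t} (\<lambda>s. ev (v s) (x s)))"
    by (rule continuous_on_add[OF continuous_on_const indefinite_integral_continuous_1])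
  moreover have "x t = x 0 + integral {0..t} (\<lambda>s. ev (v s) (x s))" if "t \<in> {0..1}" for t
  proof -
    have "((\<lambda>s. ev (v s) (x s)) has_integral (x t - x 0)) {0..t}" using c that by (simp add: ctrl_def)
    from integral_unique[OF this] show ?thesis by simp
  qed
  ultimately show ?thesis by (rule continuous_on_eq[OF _ sym])
qed

text \<open>Gronwall with \<open>l\<close> equal to \<open>C * action v\<close>. The constant
  depends on \<open>v\<close> alone, so this yields both uniqueness of trajectories and Lipschitz
  dependence on the starting point.\<close>

lemma ctrl_stability:
  assumes i: "(\<lambda>t. norm (v t)) integrable_on {0..1}"
  shows "\<exists>L. \<forall>x y. ctrl v x \<and> ctrl v y \<longrightarrow> (\<forall>t\<in>{0..1}. norm (x t - y t) \<le> L * norm (x 0 - y 0))"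
proof -
  obtain n where n: "2 * (C * action v 1) \<le> real n" using real_arch_simple by blast
  have "norm (x t - y t) \<le> 2 ^ n * norm (x 0 - y 0)"
    if c: "ctrl v x" "ctrl v y" and t: "t \<in> {0..1}" for x y t
  proof (rule gronwall_doubling[where w = "\<lambda>t. norm (x t - y t)" and l = "\<lambda>t. C * action v t"])
    show "continuous_on {0..1} (\<lambda>t. norm (x t - y t))"
      using c by (intro continuous_on_norm continuous_on_diff ctrl_continuous)
    show "continuous_on {0..1} (\<lambda>t. C * action v t)"
      by (rule continuous_on_mult_left[OF action_continuous[OF i]])
    show "C * action v a \<le> C * action v b" if "0 \<le> a" "a \<le> b" "b \<le> 1" for a b
      using action_mono[OF i that] C_pos by simp
    show "norm (x b - y b) \<le> norm (x a - y a) + (C * action v b - C * action v a) * W"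
      if ab: "0 \<le> a" "a \<le> b" "b \<le> 1" and W: "\<And>s. s \<in> {a..b} \<Longrightarrow> norm (x s - y s) \<le> W" for a b W
    proof -
      have f: "((\<lambda>s. ev (v s) (x s) - ev (v s) (y s)) has_integral ((x b - x a) - (y b - y a))) {a..b}"
        by (intro has_integral_diff ctrl_diff c ab)
      have g: "((\<lambda>s. (C * W) * norm (v s)) has_integral (C * W) * (action v b - action v a)) {a..b}"
        by (intro has_integral_mult_right action_diff i ab)
      have "norm (ev (v s) (x s) - ev (v s) (y s)) \<le> (C * W) * norm (v s)" if "s \<in> {a..b}" for s
      proof -
        have "C * norm (v s) * norm (x s - y s) \<le> C * norm (v s) * W"
          using W[OF that] C_pos by (intro mult_left_mono) auto
        then show ?thesis using ev_lip[of "v s" "x s" "y s"] by (simp add: ac_simps)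
      qed
      then have "norm (integral {a..b} (\<lambda>s. ev (v s) (x s) - ev (v s) (y s))) \<le> integral {a..b} (\<lambda>s. (C * W) * norm (v s))"
        using f g by (intro Henstock_Kurzweil_Integration.integral_norm_bound_integral) auto
      then have "norm ((x b - x a) - (y b - y a)) \<le> (C * W) * (action v b - action v a)"
        by (simp only: integral_unique[OF f] integral_unique[OF g])
      moreover have "x b - y b = (x a - y a) + ((x b - x a) - (y b - y a))" by simp
      then have "norm (x b - y b) \<le> norm (x a - y a) + norm ((x b - x a) - (y b - y a))"
        by (rule ord_eq_le_trans[OF arg_cong[where f = norm] norm_triangle_ineq])
      ultimately show ?thesis by (simp add: algebra_simps)
    qed
    have "C * action v t \<le> C * action v 1" using action_mono[OF i, of t 1] t C_pos by simp
    then show "C * action v t - C * action v 0 \<le> real n / 2" using n by (simp add: action_def)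
  qed (use t in auto)
  then show ?thesis by blast
qed

text \<open>The witness is the path reparametrized by arc length.\<close>

lemma ctrl_reach:
  assumes c: "ctrl v x"
  shows "reach (action v 1) (x 0) (x 1)"
proof -
  have i: "(\<lambda>t. norm (v t)) integrable_on {0..1}" using c by (simp add: ctrl_def)
  define L where "L = action v 1"
  have a0: "action v 0 = 0" by (simp add: action_def)
  have L0: "L \<ge> 0" using action_mono[OF i, of 0 1] a0 by (simp add: L_def)
  have "\<exists>\<tau>. \<tau> \<in> {0..1} \<and> action v \<tau> = \<sigma>" if "\<sigma> \<in> {0..L}" for \<sigma>
    using IVT'[of "action v" 0 \<sigma> 1] action_continuous[OF i] that a0 by (auto simp: L_def)
  then have "\<exists>\<tau>. \<forall>\<sigma>\<in>{0..L}. \<tau> \<sigma> \<in> {0..1} \<and> action v (\<tau> \<sigma>) = \<sigma>" by (intro bchoice) blast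
  then obtain \<tau> where "\<forall>\<sigma>\<in>{0..L}. \<tau> \<sigma> \<in> {0..1} \<and> action v (\<tau> \<sigma>) = \<sigma>" ..
  note \<tau> = bspec[OF this]
  have same: "x s = x t" if "s \<in> {0..1}" "t \<in> {0..1}" "action v s = action v t" for s t
  proof (cases "s \<le> t")
    case True
    then show ?thesis using ctrl_norm[OF c, of s t] that by simp
  next
    case False
    then show ?thesis using ctrl_norm[OF c, of t s] that by simp
  qed
  \<comment> \<open>The map \<open>\<tau>\<close> is an arbitrary right inverse of the length. If it
    inverts the order of two arguments, monotonicity of the length forces them to coincide.\<close>
  have "upath L (\<lambda>\<sigma>. x (\<tau> \<sigma>))"
    unfolding upath_def
  proof (intro conjI allI impI L0)
    fix p q a assume pq: "0 \<le> p \<and> p \<le> q \<and> q \<le> L"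
    have t: "\<tau> p \<in> {0..1}" "\<tau> q \<in> {0..1}" "action v (\<tau> p) = p" "action v (\<tau> q) = q"
      using \<tau>[of p] \<tau>[of q] pq by auto
    have "norm (x (\<tau> q) - x (\<tau> p)) \<le> C * (q - p) \<and>
      inner a (x (\<tau> q) - x (\<tau> p)) \<le> (q - p) * (norm (k (x (\<tau> p)) a) + C\<^sup>2 * (q - p) * norm a)"
    proof (cases "\<tau> p \<le> \<tau> q")
      case True
      then show ?thesis using ctrl_norm[OF c, of "\<tau> p" "\<tau> q"] ctrl_inner[OF c, of "\<tau> p" "\<tau> q" a] t by simp
    next
      case False
      then have "q \<le> p" using action_mono[OF i, of "\<tau> q" "\<tau> p"] t by simp
      then have "p = q" using pq by simp
      then show ?thesis by simp
    qed
    then show "norm (x (\<tau> q) - x (\<tau> p)) \<le> C * (q - p)"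
      "inner a (x (\<tau> q) - x (\<tau> p)) \<le> (q - p) * (norm (k (x (\<tau> p)) a) + C\<^sup>2 * (q - p) * norm a)" by auto
  qed
  moreover have "x (\<tau> 0) = x 0" "x (\<tau> L) = x 1"
    using \<tau>[of 0] \<tau>[of L] L0 by (auto intro!: same simp: a0 L_def)
  ultimately show ?thesis unfolding reach_def L_def by (intro exI[of _ "\<lambda>\<sigma>. x (\<tau> \<sigma>)"]) (simp add: L_def)
qed

section \<open>Continuously differentiable paths and the Riemannian distance\<close>

lemma C1_path_derivative:
  assumes "C1_path g" "t \<in> {0..1}"
  shows "(g has_vector_derivative vector_derivative g (at t within {0..1})) (at t within {0..1})"
  using assms unfolding C1_path_def by (simp add: vector_derivative_works)

text \<open>The cheapest control at each time that moves the point along \<open>g\<close>; its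
  length is the Riemannian length of \<open>g\<close>.\<close>

definition velocity_lift :: "(real \<Rightarrow> real^'n) \<Rightarrow> real \<Rightarrow> 'v" where
  "velocity_lift g t = lift (g t) (vector_derivative g (at t within {0..1}))"

lemma norm_velocity_lift: "norm (velocity_lift g t) = speed (kernel_metric K) g t"
  by (simp add: velocity_lift_def speed_def Let_def norm_lift)

lemma continuous_velocity_lift:
  assumes "C1_path g"
  shows "continuous_on {0..1} (velocity_lift g)"
proof -
  have "continuous_on {0..1} g"
    using assms unfolding C1_path_def by (auto intro: differentiable_imp_continuous_on simp: differentiable_on_def)
  then show ?thesis
    using assms unfolding velocity_lift_def C1_path_def by (intro continuous_on_lift) auto
qed

lemma ctrl_velocity_lift:
  assumes g: "C1_path g"
  shows "ctrl (velocity_lift g) g"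
  unfolding ctrl_def
proof (intro conjI ballI)
  show "(\<lambda>t. norm (velocity_lift g t)) integrable_on {0..1}"
    by (intro integrable_continuous_real continuous_on_norm continuous_velocity_lift g)
  fix t :: real assume t: "t \<in> {0..1}"
  have "(vector_derivative g (at s within {0..1})) = ev (velocity_lift g s) (g s)" for s
    by (simp add: velocity_lift_def ev_lift)
  then have "(g has_vector_derivative ev (velocity_lift g s) (g s)) (at s within {0..t})" if "s \<in> {0..t}" for s
    using C1_path_derivative[OF g, of s] that t by (auto intro: has_vector_derivative_within_subset)
  then show "((\<lambda>s. ev (velocity_lift g s) (g s)) has_integral (g t - g 0)) {0..t}"
    using t by (intro fundamental_theorem_of_calculus) auto
qed

text \<open>This is \<open>minimal_upath_C1\<close> rescaled to the unit interval, in terms of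
  increments, so that it covers both a rescaled least duration path and the trajectory of an optimal
  control.\<close>

lemma minimal_path_C1:
  assumes T: "T \<ge> 0"
    and lip: "\<And>s t. 0 \<le> s \<Longrightarrow> s \<le> t \<Longrightarrow> t \<le> 1 \<Longrightarrow> norm (x t - x s) \<le> C * (T * (t - s))"
    and inn: "\<And>s t a. 0 \<le> s \<Longrightarrow> s \<le> t \<Longrightarrow> t \<le> 1 \<Longrightarrow>
      inner a (x t - x s) \<le> (T * (t - s)) * (norm (k (x s) a) + C\<^sup>2 * (T * (t - s)) * norm a)"
    and min: "\<And>S. reach S (x 0) (x 1) \<Longrightarrow> T \<le> S"
  shows "C1_path x \<and> (\<forall>t\<in>{0..1}. speed (kernel_metric K) x t = T)"
proof -
  have "\<exists>u. continuous_on {0..1} u \<and>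
    (\<forall>t\<in>{0..1}. (x has_vector_derivative u t) (at t within {0..1}) \<and> norm (lift (x t) (u t)) = T)"
  proof (cases "T = 0")
    \<comment> \<open>Duration zero admits no rescaling; the Lipschitz bound then makes the path
      constant.\<close>
    case True
    have "x t = x 0" if "t \<in> {0..1}" for t using lip[of 0 t] that True by simp
    then have "(x has_vector_derivative 0) (at t within {0..1})" if "t \<in> {0..1}" for t
      by (rule has_vector_derivative_transform[OF that _ has_vector_derivative_const])
    then show ?thesis using True by (intro exI[of _ "\<lambda>_. 0"]) (simp add: lift_0)
  next
    case False
    then have Tp: "T > 0" using T by simp
    define z where "z s = x (s / T)" for s
    have xz: "x = z \<circ> (\<lambda>t. T * t)" using Tp by (simp add: z_def o_def)
    have Tst: "T * (t / T - s / T) = t - s" for s t using Tp by (simp add: right_diff_distrib)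
    have "upath T z"
      unfolding upath_def
    proof (intro conjI allI impI T)
      fix s t a assume st: "0 \<le> s \<and> s \<le> t \<and> t \<le> T"
      then have st': "0 \<le> s / T" "s / T \<le> t / T" "t / T \<le> 1" using Tp by (auto simp: divide_right_mono)
      show "norm (z t - z s) \<le> C * (t - s)"
        using lip[OF st'] by (simp only: z_def Tst)
      show "inner a (z t - z s) \<le> (t - s) * (norm (k (z s) a) + C\<^sup>2 * (t - s) * norm a)"
        using inn[OF st', of a] by (simp only: z_def Tst)
    qed
    moreover have "T \<le> S" if "reach S (z 0) (z T)" for S using min that Tp by (simp add: z_def)
    ultimately obtain u where u: "continuous_on {0..T} u"
      "\<And>t. t \<in> {0..T} \<Longrightarrow> (z has_vector_derivative u t) (at t within {0..T}) \<and> norm (lift (z t) (u t)) = 1"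
      using minimal_upath_C1[of T z] Tp by blast
    have im: "(\<lambda>t. T * t) ` {0..1} = {0..T}"
      using image_mult_atLeastAtMost[of T 0 1] Tp by simp
    show ?thesis
    proof (intro exI[of _ "\<lambda>t. T *\<^sub>R u (T * t)"] conjI ballI)
      show "continuous_on {0..1} (\<lambda>t. T *\<^sub>R u (T * t))"
        using im by (intro continuous_intros continuous_on_compose2[OF u(1)]) auto
      fix t :: real assume t: "t \<in> {0..1}"
      have tT: "T * t \<in> {0..T}" using t im by blast
      have "((\<lambda>t. T * t) has_vector_derivative T) (at t within {0..1})"
        by (auto intro!: derivative_eq_intros simp: has_real_derivative_iff_has_vector_derivative[symmetric])
      then show "(x has_vector_derivative T *\<^sub>R u (T * t)) (at t within {0..1})"
        unfolding xz using u(2)[OF tT] im by (intro vector_diff_chain_within) auto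
      have "norm (lift (z (T * t)) (u (T * t))) = 1" using u(2)[OF tT] by blast
      then show "norm (lift (x t) (T *\<^sub>R u (T * t))) = T" using Tp by (simp add: xz lift_scale)
    qed
  qed
  then obtain u where u: "continuous_on {0..1} u"
    "\<And>t. t \<in> {0..1} \<Longrightarrow> (x has_vector_derivative u t) (at t within {0..1})"
    "\<And>t. t \<in> {0..1} \<Longrightarrow> norm (lift (x t) (u t)) = T" by blast
  have vd: "vector_derivative x (at t within {0..1}) = u t" if "t \<in> {0..1}" for t
    using that u(2) by (intro vector_derivative_within_closed_interval) auto
  have "C1_path x"
    unfolding C1_path_def
  proof
    show "\<forall>t\<in>{0..1}. x differentiable at t within {0..1}" using u(2) differentiableI_vector by blast
    show "continuous_on {0..1} (\<lambda>t. vector_derivative x (at t within {0..1}))"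
      by (rule continuous_on_eq[OF u(1) vd[symmetric]])
  qed
  moreover have "speed (kernel_metric K) x t = T" if "t \<in> {0..1}" for t
    using u(3)[OF that] vd[OF that] norm_velocity_lift[of x t] by (simp add: velocity_lift_def)
  ultimately show ?thesis by blast
qed

lemma curve_length_action: "curve_length (kernel_metric K) g = action (velocity_lift g) 1"
  by (simp add: curve_length_def action_def norm_velocity_lift)

text \<open>The Riemannian distance is the least duration: a least duration path is itself a
  \<open>C1_path\<close> of that length, and any competitor is a trajectory of its velocity lift,
  hence reaches \<open>y\<close> in a time equal to its length.\<close>

lemma riemannian_dist_reach:
  shows "reach (riemannian_dist (kernel_metric K) x y) x y"
    and "reach S x y \<Longrightarrow> riemannian_dist (kernel_metric K) x y \<le> S"
    and "\<exists>g. minimizing_geodesic (kernel_metric K) x y g"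
proof -
  obtain D where D: "reach D x y" "\<And>S. reach S x y \<Longrightarrow> D \<le> S" using reach_min by blast
  then obtain z where z: "upath D z" "z 0 = x" "z D = y" unfolding reach_def by blast
  have D0: "D \<ge> 0" using D(1) by (rule reach_nonneg)
  define g where "g t = z (D * t)" for t
  have g: "C1_path g \<and> (\<forall>t\<in>{0..1}. speed (kernel_metric K) g t = D)"
  proof (rule minimal_path_C1[OF D0])
    fix s t :: real and a assume st: "0 \<le> s" "s \<le> t" "t \<le> 1"
    have st': "0 \<le> D * s" "D * s \<le> D * t" "D * t \<le> D" using st D0 by (auto simp: mult_left_mono mult_left_le)
    show "norm (g t - g s) \<le> C * (D * (t - s))"
      using upathD(1)[OF z(1) st'] by (simp add: g_def right_diff_distrib)
    show "inner a (g t - g s) \<le> (D * (t - s)) * (norm (k (g s) a) + C\<^sup>2 * (D * (t - s)) * norm a)"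
      using upathD(2)[OF z(1) st', of a] by (simp add: g_def right_diff_distrib)
  qed (use D z in \<open>simp add: g_def\<close>)
  have ends: "g 0 = x" "g 1 = y" using z by (auto simp: g_def)
  have len: "curve_length (kernel_metric K) g = D"
    unfolding curve_length_def using g integral_cong[of "{0..1}" "speed (kernel_metric K) g" "\<lambda>_. D"] by simp
  have lower: "D \<le> curve_length (kernel_metric K) h" if "C1_path h" "h 0 = x" "h 1 = y" for h
    using D(2) ctrl_reach[OF ctrl_velocity_lift[OF that(1)]] that by (simp add: curve_length_action)
  have "riemannian_dist (kernel_metric K) x y = D"
    unfolding riemannian_dist_def
  proof (rule antisym)
    show "(INF g\<in>{g. C1_path g \<and> g 0 = x \<and> g 1 = y}. curve_length (kernel_metric K) g) \<le> D"
      using g ends lower by (subst len[symmetric], intro cINF_lower bdd_belowI2[where m = D]) auto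
    show "D \<le> (INF g\<in>{g. C1_path g \<and> g 0 = x \<and> g 1 = y}. curve_length (kernel_metric K) g)"
      using g ends lower by (intro cINF_greatest) auto
  qed
  then show "reach (riemannian_dist (kernel_metric K) x y) x y"
    "reach S x y \<Longrightarrow> riemannian_dist (kernel_metric K) x y \<le> S"
    "\<exists>g. minimizing_geodesic (kernel_metric K) x y g"
    using D g ends len unfolding minimizing_geodesic_def by auto
qed

end

subsection \<open>Existence of flows\<close>

text \<open>Relative to the weight \<open>exp (2 * \<Lambda> * t)\<close> each Picard step contracts
  by 1/2, so the iteration converges on all of \<open>{0..1}\<close> at once.\<close>

lemma picard_solution:
  fixes f :: "real \<Rightarrow> 'a::euclidean_space \<Rightarrow> 'a"
  assumes cont: "\<And>y. continuous_on {0..1} y \<Longrightarrow> continuous_on {0..1} (\<lambda>s. f s (y s))"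
    and lip: "\<And>s a b. s \<in> {0..1} \<Longrightarrow> norm (f s a - f s b) \<le> \<Lambda> * norm (a - b)"
    and bound: "\<And>s a. s \<in> {0..1} \<Longrightarrow> norm (f s a) \<le> \<Lambda>"
    and \<Lambda>: "\<Lambda> > 0"
  shows "\<exists>y. \<forall>t\<in>{0..1}. ((\<lambda>s. f s (y s)) has_integral (y t - x)) {0..t}"
proof -
  define Y where "Y n = ((\<lambda>y t. x + integral {0..t} (\<lambda>s. f s (y s))) ^^ n) (\<lambda>_. x)" for n
  have Y0: "Y 0 = (\<lambda>_. x)" and YS: "Y (Suc n) = (\<lambda>t. x + integral {0..t} (\<lambda>s. f s (Y n s)))" for n
    by (simp_all add: Y_def)
  have cY: "continuous_on {0..1} (Y n)" for n
  proof (induction n)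
    case 0
    then show ?case by (simp add: Y0)
  next
    case (Suc n)
    show ?case unfolding YS
      by (rule continuous_on_add[OF continuous_on_const indefinite_integral_continuous_1[OF integrable_continuous_real[OF cont[OF Suc]]]])
  qed
  have int: "(\<lambda>s. f s (Y n s)) integrable_on {0..t}" if "t \<in> {0..1}" for n t
    by (rule integrable_continuous_real[OF continuous_on_subset[OF cont[OF cY]]]) (use that in auto)
  have diff: "norm (Y (Suc n) t - Y n t) \<le> (1 / 2) ^ n * exp (2 * \<Lambda> * t)" if "t \<in> {0..1}" for n t
    using that
  proof (induction n arbitrary: t)
    case 0
    have "norm (integral {0..t} (\<lambda>s. f s x)) \<le> \<Lambda> * (t - 0)"
      using 0 int[of t 0] bound by (intro integral_bound cont) (auto simp: Y0 intro!: continuous_on_subset[OF cont[OF cY[of 0]], unfolded Y0])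
    also have "\<dots> \<le> 2 * \<Lambda> * t" using \<Lambda> 0 by simp
    also have "\<dots> \<le> exp (2 * \<Lambda> * t)" using exp_ge_add_one_self[of "2 * \<Lambda> * t"] by linarith
    finally show ?case by (simp add: YS Y0)
  next
    case (Suc n)
    have g: "((\<lambda>s. \<Lambda> * ((1 / 2) ^ n * exp (2 * \<Lambda> * s))) has_integral
        ((1 / 2) ^ Suc n * exp (2 * \<Lambda> * t) - (1 / 2) ^ Suc n * exp (2 * \<Lambda> * 0))) {0..t}"
      using Suc.prems by (intro fundamental_theorem_of_calculus)
        (auto intro!: derivative_eq_intros simp: has_real_derivative_iff_has_vector_derivative[symmetric])
    have "Y (Suc (Suc n)) t - Y (Suc n) t = integral {0..t} (\<lambda>s. f s (Y (Suc n) s)) - integral {0..t} (\<lambda>s. f s (Y n s))"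
      by (subst YS[of "Suc n"], subst (2) YS[of n]) simp
    also have "\<dots> = integral {0..t} (\<lambda>s. f s (Y (Suc n) s) - f s (Y n s))"
      by (rule integral_diff[symmetric]) (rule int[OF Suc.prems])+
    also have "norm \<dots> \<le> integral {0..t} (\<lambda>s. \<Lambda> * ((1 / 2) ^ n * exp (2 * \<Lambda> * s)))"
    proof (rule Henstock_Kurzweil_Integration.integral_norm_bound_integral)
      show "(\<lambda>s. f s (Y (Suc n) s) - f s (Y n s)) integrable_on {0..t}"
        by (intro integrable_diff int[OF Suc.prems])
      show "(\<lambda>s. \<Lambda> * ((1 / 2) ^ n * exp (2 * \<Lambda> * s))) integrable_on {0..t}" using g by (rule has_integral_integrable)
      fix s assume s: "s \<in> {0..t}"
      then have s1: "s \<in> {0..1}" using Suc.prems by auto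
      have "norm (f s (Y (Suc n) s) - f s (Y n s)) \<le> \<Lambda> * norm (Y (Suc n) s - Y n s)" by (rule lip[OF s1])
      also have "\<dots> \<le> \<Lambda> * ((1 / 2) ^ n * exp (2 * \<Lambda> * s))" using Suc.IH[OF s1] \<Lambda> by (intro mult_left_mono) auto
      finally show "norm (f s (Y (Suc n) s) - f s (Y n s)) \<le> \<Lambda> * ((1 / 2) ^ n * exp (2 * \<Lambda> * s))" .
    qed
    also have "\<dots> \<le> (1 / 2) ^ Suc n * exp (2 * \<Lambda> * t)" unfolding integral_unique[OF g] by simp
    finally show ?case .
  qed
  have tele: "(\<Sum>i<n. Y (Suc i) t - Y i t) = Y n t - x" for n t
    using sum_lessThan_telescope[of "\<lambda>i. Y i t" n] by (simp add: Y0)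
  have "uniform_limit {0..1} (\<lambda>n t. \<Sum>i<n. Y (Suc i) t - Y i t) (\<lambda>t. suminf (\<lambda>i. Y (Suc i) t - Y i t)) sequentially"
  proof (rule Weierstrass_m_test)
    show "norm (Y (Suc n) t - Y n t) \<le> (1 / 2) ^ n * exp (2 * \<Lambda>)" if "t \<in> {0..1}" for n t
    proof (rule order_trans[OF diff[OF that]])
      show "(1 / 2) ^ n * exp (2 * \<Lambda> * t) \<le> (1 / 2) ^ n * exp (2 * \<Lambda>)" using that \<Lambda> by (intro mult_left_mono) auto
    qed
    show "summable (\<lambda>n. (1 / 2) ^ n * exp (2 * \<Lambda>))" by (intro summable_mult2 summable_geometric) simp
  qed
  then have "uniform_limit {0..1} (\<lambda>n t. x + (Y n t - x)) (\<lambda>t. x + suminf (\<lambda>i. Y (Suc i) t - Y i t)) sequentially"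
    unfolding tele by (intro uniform_limit_add uniform_limit_const)
  then obtain y where y: "uniform_limit {0..1} Y y sequentially" by (auto simp: add.commute)
  have cy: "continuous_on {0..1} y"
    by (rule uniform_limit_theorem[OF always_eventually y]) (use cY in auto)
  have u: "uniform_limit {0..1} (\<lambda>n s. f s (Y n s)) (\<lambda>s. f s (y s)) sequentially"
  proof (rule uniform_limitI)
    fix e :: real assume e: "e > 0"
    then have "eventually (\<lambda>n. \<forall>s\<in>{0..1}. dist (Y n s) (y s) < e / \<Lambda>) sequentially"
      using uniform_limitD[OF y, of "e / \<Lambda>"] \<Lambda> by simp
    then show "eventually (\<lambda>n. \<forall>s\<in>{0..1}. dist (f s (Y n s)) (f s (y s)) < e) sequentially"
    proof eventually_elim
      case (elim n)
      show ?case
      proof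
        fix s :: real assume s: "s \<in> {0..1}"
        have "dist (f s (Y n s)) (f s (y s)) \<le> \<Lambda> * dist (Y n s) (y s)" unfolding dist_norm by (rule lip[OF s])
        also have "\<dots> < e" using elim s \<Lambda> by (simp add: pos_less_divide_eq mult.commute)
        finally show "dist (f s (Y n s)) (f s (y s)) < e" .
      qed
    qed
  qed
  have "((\<lambda>s. f s (y s)) has_integral (y t - x)) {0..t}" if t: "t \<in> {0..1}" for t
  proof -
    have sub: "{0..t} \<subseteq> {0..1}" using t by auto
    obtain I J where I: "\<And>n. ((\<lambda>s. f s (Y n s)) has_integral I n) {0..t}"
      and J: "((\<lambda>s. f s (y s)) has_integral J) {0..t}" and IJ: "I \<longlonglongrightarrow> J"
    proof (rule uniform_limit_integral[OF uniform_limit_on_subset[OF u sub]])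
      show "continuous_on {0..t} (\<lambda>s. f s (Y n s))" for n
        by (rule continuous_on_subset[OF cont[OF cY] sub])
    qed auto
    \<comment> \<open>The integrals are the next iterates, so their limit must be that of the
      iterates themselves.\<close>
    have "I n = Y (Suc n) t - x" for n using integral_unique[OF I[of n]] by (simp add: YS)
    then have "I = (\<lambda>n. Y (Suc n) t - x)" by (rule ext)
    then have "(\<lambda>n. Y (Suc n) t - x) \<longlonglongrightarrow> J" using IJ by (simp only:)
    moreover have "(\<lambda>n. Y (Suc n) t - x) \<longlonglongrightarrow> y t - x"
      by (rule tendsto_diff[OF LIMSEQ_Suc[OF tendsto_uniform_limitI[OF y t]] tendsto_const])
    ultimately show ?thesis using J LIMSEQ_unique by blast
  qed
  then show ?thesis by blast
qed


subsection \<open>Weights and Dirac measures\<close>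

lemma prob_space_unit_interval: "prob_space (lebesgue_on {0..1::real})"
  by (rule prob_spaceI) (simp add: emeasure_restrict_space space_restrict_space)

lemma L2_unit_integrable:
  assumes "L2_unit f"
  shows "integrable (lebesgue_on {0..1}) (\<lambda>t. norm (f t))"
    and "integrable (lebesgue_on {0..1}) (\<lambda>t. (norm (f t))\<^sup>2)"
proof -
  interpret prob_space "lebesgue_on {0..1::real}" by (rule prob_space_unit_interval)
  have f: "f \<in> borel_measurable (lebesgue_on {0..1})" and
    sq: "integrable (lebesgue_on {0..1}) (\<lambda>t. (norm (f t))\<^sup>2)" using assms by (auto simp: L2_unit_def)
  show "integrable (lebesgue_on {0..1}) (\<lambda>t. (norm (f t))\<^sup>2)" by (rule sq)
  have m: "(\<lambda>t. norm (f t)) \<in> borel_measurable (lebesgue_on {0..1})"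
    by (rule measurable_compose[OF f borel_measurable_continuous_onI]) (rule continuous_on_norm_id)
  show "integrable (lebesgue_on {0..1}) (\<lambda>t. norm (f t))"
  proof (rule Bochner_Integration.integrable_bound[OF _ m])
    show "integrable (lebesgue_on {0..1}) (\<lambda>t. 1 + (norm (f t))\<^sup>2)" using sq by simp
    have "norm (f t) \<le> 1 + (norm (f t))\<^sup>2" for t
      using zero_le_power2[of "norm (f t) - 1"] by (simp add: power2_diff) (smt (verit) norm_ge_zero zero_le_power2)
    then show "AE t in lebesgue_on {0..1}. norm (norm (f t)) \<le> norm (1 + (norm (f t))\<^sup>2)" by simp
  qed
qed

text \<open>The gap in the inequality is the variance of \<open>f\<close> under the uniform
  probability measure. If it closes, \<open>f\<close> is almost everywhere constant and its partial
  integrals are linear.\<close>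

lemma unit_interval_cauchy_schwarz:
  fixes f :: "real \<Rightarrow> real"
  assumes i: "integrable (lebesgue_on {0..1}) f" and i2: "integrable (lebesgue_on {0..1}) (\<lambda>t. (f t)\<^sup>2)"
  shows "(integral {0..1} f)\<^sup>2 \<le> (LINT t|lebesgue_on {0..1}. (f t)\<^sup>2)"
    and "(LINT t|lebesgue_on {0..1}. (f t)\<^sup>2) \<le> (integral {0..1} f)\<^sup>2 \<Longrightarrow> t \<in> {0..1} \<Longrightarrow>
      integral {0..t} f = integral {0..1} f * t"
proof -
  interpret prob_space "lebesgue_on {0..1::real}" by (rule prob_space_unit_interval)
  define c where "c = integral {0..1} f"
  have c: "(LINT t|lebesgue_on {0..1}. f t) = c"
    unfolding c_def using i by (intro lebesgue_integral_eq_integral) auto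
  have var: "(LINT t|lebesgue_on {0..1}. (f t - c)\<^sup>2) = (LINT t|lebesgue_on {0..1}. (f t)\<^sup>2) - c\<^sup>2"
    using variance_eq[OF i i2] by (simp add: c)
  have nonneg: "0 \<le> (LINT t|lebesgue_on {0..1}. (f t - c)\<^sup>2)"
    by (rule Bochner_Integration.integral_nonneg) (rule zero_le_power2)
  then show "(integral {0..1} f)\<^sup>2 \<le> (LINT t|lebesgue_on {0..1}. (f t)\<^sup>2)" using var unfolding c_def by linarith
  assume "(LINT t|lebesgue_on {0..1}. (f t)\<^sup>2) \<le> (integral {0..1} f)\<^sup>2" and t: "t \<in> {0..1}"
  then have z: "(LINT t|lebesgue_on {0..1}. (f t - c)\<^sup>2) = 0"
    using var nonneg unfolding c_def by linarith
  have "integrable (lebesgue_on {0..1}) (\<lambda>t. (f t)\<^sup>2 - 2 * c * f t + c\<^sup>2)"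
    using i i2 by (intro Bochner_Integration.integrable_add Bochner_Integration.integrable_diff integrable_mult_right) auto
  then have "integrable (lebesgue_on {0..1}) (\<lambda>t. (f t - c)\<^sup>2)"
    by (simp add: power2_diff algebra_simps)
  then have "AE t in lebesgue_on {0..1}. (f t - c)\<^sup>2 = 0"
    using z by (subst (asm) integral_nonneg_eq_0_iff_AE) auto
  then have "AE t in lebesgue. t \<in> {0..1} \<longrightarrow> f t = c"
    by (subst (asm) AE_restrict_space_iff) auto
  then obtain N where N: "{t \<in> space lebesgue. \<not> (t \<in> {0..1} \<longrightarrow> f t = c)} \<subseteq> N"
      and "emeasure lebesgue N = 0" "N \<in> sets lebesgue"
    by (rule AE_E)
  then have null: "N \<in> null_sets lebesgue" by (intro null_setsI)
  \<comment> \<open>The gauge integral ignores the null set, so the formula holds for every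
    \<open>t\<close>.\<close>
  have "(f has_integral c * t) {0..t}"
  proof (rule has_integral_spike)
    show "negligible N" using null by (simp add: negligible_iff_null_sets)
    show "f s = c" if "s \<in> {0..t} - N" for s using that N t by force
    show "((\<lambda>_. c) has_integral c * t) {0..t}"
      using has_integral_const_real[of c 0 t] t by (simp add: mult.commute)
  qed
  then show "integral {0..t} f = integral {0..1} f * t" unfolding c_def[symmetric] by (rule integral_unique)
qed

section \<open>Pushforward and scaling of Dirac measures\<close>

lemma emeasure_dirac: "emeasure (dirac r x) A = ennreal r * indicator A x" if "A \<in> sets borel"
  using that by (simp add: dirac_def)

lemma sets_dirac: "sets (dirac r x) = sets borel"
  by (simp add: dirac_def)

lemma distr_dirac:
  fixes f :: "real^'n \<Rightarrow> real^'n"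
  assumes f: "f \<in> borel_measurable borel"
  shows "distr (dirac r x) borel f = dirac r (f x)"
proof (rule measure_eqI)
  fix A assume "A \<in> sets (distr (dirac r x) borel f)"
  then have A: "A \<in> sets borel" by simp
  have "f \<in> measurable (dirac r x) borel" using f by (simp add: measurable_def sets_dirac sets_eq_imp_space_eq[OF sets_dirac])
  then have "emeasure (distr (dirac r x) borel f) A = emeasure (dirac r x) (f -` A)"
    using A by (subst emeasure_distr) (auto simp: sets_eq_imp_space_eq[OF sets_dirac])
  also have "\<dots> = ennreal r * indicator (f -` A) x"
    using measurable_sets[OF f A] by (intro emeasure_dirac) simp
  also have "\<dots> = emeasure (dirac r (f x)) A" using A by (simp add: emeasure_dirac indicator_def)
  finally show "emeasure (distr (dirac r x) borel f) A = emeasure (dirac r (f x)) A" .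
qed (simp add: sets_dirac)

lemma scale_dirac: "scale_measure (ennreal c) (dirac r x) = dirac (c * r) x" if "c \<ge> 0" "r \<ge> 0"
  using that by (simp add: dirac_def ennreal_mult)

text \<open>The whole space detects the mass and the singleton of \<open>x\<close> the location; a
  zero measure carries no location.\<close>

lemma dirac_eqD:
  assumes "dirac r x = dirac s y" "r \<ge> 0" "s \<ge> 0"
  shows "r = s" and "r > 0 \<Longrightarrow> x = y"
proof -
  show rs: "r = s"
    using emeasure_dirac[of UNIV r x] emeasure_dirac[of UNIV s y] assms by simp
  assume r: "r > 0"
  have "ennreal r * indicator {x} x = ennreal r * indicator {x} y"
    using emeasure_dirac[of "{x}" r x] emeasure_dirac[of "{x}" s y] assms(1) rs by simp
  then show "x = y" using r by (cases "x = y") (auto simp: indicator_def)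
qed


subsection \<open>Minimizers of the cost\<close>

context rkhs_fields
begin

lemma continuous_on_ev:
  fixes g :: "'b::topological_space \<Rightarrow> real^'n"
  assumes "continuous_on S v" and "continuous_on S g"
  shows "continuous_on S (\<lambda>t. ev (v t) (g t))"
  unfolding continuous_on_def
proof (rule ballI)
  fix t assume t: "t \<in> S"
  have vt: "(v \<longlongrightarrow> v t) (at t within S)" and gt: "(g \<longlongrightarrow> g t) (at t within S)"
    using assms t by (auto simp: continuous_on_def)
  have "((\<lambda>s. C * norm (v s) * norm (g s - g t) + C * norm (v s - v t)) \<longlongrightarrow>
      C * norm (v t) * norm (g t - g t) + C * norm (v t - v t)) (at t within S)"
    by (intro tendsto_intros vt gt)
  then have lim: "((\<lambda>s. C * norm (v s) * norm (g s - g t) + C * norm (v s - v t)) \<longlongrightarrow> 0) (at t within S)"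
    by simp
  have "norm (ev (v s) (g s) - ev (v t) (g t)) \<le> C * norm (v s) * norm (g s - g t) + C * norm (v s - v t)" for s
  proof -
    have "ev (v s) (g s) - ev (v t) (g t) = (ev (v s) (g s) - ev (v s) (g t)) + ev (v s - v t) (g t)"
      by (simp add: ev_diff)
    then have "norm (ev (v s) (g s) - ev (v t) (g t)) \<le> norm (ev (v s) (g s) - ev (v s) (g t)) + norm (ev (v s - v t) (g t))"
      by (rule ord_eq_le_trans[OF arg_cong[where f = norm] norm_triangle_ineq])
    then show ?thesis
      using ev_lip[of "v s" "g s" "g t"] ev_bound[of "v s - v t" "g t"] by linarith
  qed
  then have "((\<lambda>s. ev (v s) (g s) - ev (v t) (g t)) \<longlongrightarrow> 0) (at t within S)"
    by (intro Lim_null_comparison[OF always_eventually lim]) auto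
  then show "((\<lambda>s. ev (v s) (g s)) \<longlongrightarrow> ev (v t) (g t)) (at t within S)"
    by (simp add: LIM_zero_iff)
qed

lemma flow_exists:
  fixes v :: "real \<Rightarrow> 'v"
  assumes v: "continuous_on {0..1} v"
  shows "\<exists>y. \<forall>t\<in>{0..1}. ((\<lambda>s. ev (v s) (y s)) has_integral (y t - x)) {0..t}"
proof -
  have "compact ((\<lambda>t. norm (v t)) ` {0..1})"
    by (intro compact_continuous_image continuous_on_norm v compact_Icc)
  then have "bdd_above ((\<lambda>t. norm (v t)) ` {0..1})"
    by (intro bounded_imp_bdd_above compact_imp_bounded)
  then obtain B where B: "\<And>t. t \<in> {0..1} \<Longrightarrow> norm (v t) \<le> B"
    unfolding bdd_above_def by (metis imageI)
  define \<Lambda> where "\<Lambda> = C * max B 1"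
  have b: "C * norm (v s) \<le> \<Lambda>" if "s \<in> {0..1}" for s
    unfolding \<Lambda>_def using B[OF that] C_pos by (intro mult_left_mono) auto
  show ?thesis
  proof (rule picard_solution)
    show "continuous_on {0..1} (\<lambda>s. ev (v s) (y s))" if "continuous_on {0..1} y" for y
      by (rule continuous_on_ev[OF v that])
    show "norm (ev (v s) a - ev (v s) b) \<le> \<Lambda> * norm (a - b)" if "s \<in> {0..1}" for s a b
      by (rule order_trans[OF ev_lip mult_right_mono[OF b[OF that] norm_ge_zero]])
    show "norm (ev (v s) a) \<le> \<Lambda>" if "s \<in> {0..1}" for s a
      by (rule order_trans[OF ev_bound b[OF that]])
    show "\<Lambda> > 0" using C_pos by (simp add: \<Lambda>_def)
  qed
qed

section \<open>Flows of square integrable controls\<close>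

lemma L2_norm_integrable_on: "L2_unit v \<Longrightarrow> (\<lambda>t. norm (v t)) integrable_on {0..1}"
  using has_integral_integral_lebesgue_on[OF L2_unit_integrable(1)] by (auto intro: has_integral_integrable)

lemma flow_ctrl:
  assumes v: "L2_unit v" and \<phi>: "is_flow ev v \<phi>"
  shows "\<phi> 0 x = x" and "ctrl v (\<lambda>t. \<phi> t x)"
proof -
  have h: "((\<lambda>s. ev (v s) (\<phi> s x)) has_integral (\<phi> t x - x)) {0..t}" if "t \<in> {0..1}" for t
    using \<phi> that by (auto simp: is_flow_def)
  show x: "\<phi> 0 x = x" using h[of 0] has_integral_unique[OF has_integral_refl(2)] by fastforce
  show "ctrl v (\<lambda>t. \<phi> t x)"
    unfolding ctrl_def x using h L2_norm_integrable_on[OF v] by blast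
qed

lemma flow_unique:
  assumes v: "L2_unit v" and "is_flow ev v \<phi>" "is_flow ev v \<psi>" "t \<in> {0..1}"
  shows "\<phi> t x = \<psi> t x"
proof -
  obtain L where "\<forall>x y. ctrl v x \<and> ctrl v y \<longrightarrow> (\<forall>t\<in>{0..1}. norm (x t - y t) \<le> L * norm (x 0 - y 0))"
    using ctrl_stability[OF L2_norm_integrable_on[OF v]] ..
  note L = this[rule_format, OF conjI]
  show ?thesis
    using L[OF flow_ctrl(2)[OF v assms(2), of x] flow_ctrl(2)[OF v assms(3), of x] assms(4)]
    by (simp add: flow_ctrl(1)[OF v assms(2)] flow_ctrl(1)[OF v assms(3)])
qed

text \<open>The predicate \<open>is_flow\<close> treats each starting point separately, so
  regularity in space has to come from the stability estimate. The pushforward formula for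
  \<open>distr\<close> relies on it.\<close>

lemma flow_measurable:
  assumes v: "L2_unit v" and \<phi>: "is_flow ev v \<phi>" and t: "t \<in> {0..1}"
  shows "\<phi> t \<in> borel_measurable borel"
proof -
  obtain L where "\<forall>x y. ctrl v x \<and> ctrl v y \<longrightarrow> (\<forall>t\<in>{0..1}. norm (x t - y t) \<le> L * norm (x 0 - y 0))"
    using ctrl_stability[OF L2_norm_integrable_on[OF v]] ..
  note L = this[rule_format, OF conjI]
  have l: "norm (\<phi> t x - \<phi> t y) \<le> max L 0 * norm (x - y)" for x y
  proof -
    have "norm (\<phi> t x - \<phi> t y) \<le> L * norm (x - y)"
      using L[OF flow_ctrl(2)[OF v \<phi>, of x] flow_ctrl(2)[OF v \<phi>, of y] t] by (simp add: flow_ctrl(1)[OF v \<phi>])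
    also have "\<dots> \<le> max L 0 * norm (x - y)" by (intro mult_right_mono) auto
    finally show ?thesis .
  qed
  have "(max L 0)-lipschitz_on UNIV (\<phi> t)"
    using l by (intro lipschitz_onI) (auto simp: dist_norm)
  then show ?thesis
    by (intro borel_measurable_continuous_onI lipschitz_on_continuous_on)
qed

lemma transported_dirac:
  assumes "L2_unit v" "is_flow ev v \<phi>" "t \<in> {0..1}" "r \<ge> 0"
  shows "transported r x \<eta> \<phi> t = dirac ((weight \<eta> t)\<^sup>2 * r) (\<phi> t x)"
  unfolding transported_def using assms by (simp add: distr_dirac[OF flow_measurable] scale_dirac)

lemma L2_real_facts:
  assumes "L2_unit (\<eta> :: real \<Rightarrow> real)"
  shows "integrable (lebesgue_on {0..1}) \<eta>" and "integrable (lebesgue_on {0..1}) (\<lambda>t. (\<eta> t)\<^sup>2)"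
proof -
  have m: "\<eta> \<in> borel_measurable (lebesgue_on {0..1})" using assms by (simp add: L2_unit_def)
  show "integrable (lebesgue_on {0..1}) \<eta>"
    by (rule integrable_norm_cancel[OF L2_unit_integrable(1)[OF assms] m])
  show "integrable (lebesgue_on {0..1}) (\<lambda>t. (\<eta> t)\<^sup>2)" using L2_unit_integrable(2)[OF assms] by simp
qed

section \<open>The minimization problem for two fixed Dirac measures\<close>

context
  fixes x0 x1 :: "real^'n" and \<gamma> r0 r1 :: real
  assumes \<gamma>: "\<gamma> > 0" and r0: "r0 > 0" and r1: "r1 \<ge> 0" and x1: "r1 = 0 \<Longrightarrow> x1 = x0"
begin

abbreviation (input) dist_K :: real where
  "dist_K \<equiv> riemannian_dist (kernel_metric K) x0 x1"

lemma dist_K_nonneg: "dist_K \<ge> 0"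
  by (rule reach_nonneg[OF riemannian_dist_reach(1)])

text \<open>The sign condition on the weight selects the positive root of \<open>r1 / r0\<close>,
  which fixes the integral of \<open>\<eta>\<close>. The endpoint is stated for an arbitrary flow
  \<open>\<phi>\<close> because a geodesic may be presented with a flow other than the one
  witnessing admissibility.\<close>

lemma admissible_facts:
  assumes a: "(v, \<eta>) \<in> admissible ev r0 x0 (dirac r1 x1)"
  shows "L2_unit v" "L2_unit \<eta>" "integral {0..1} \<eta> = 2 * (sqrt (r1 / r0) - 1)"
    and "is_flow ev v \<phi> \<Longrightarrow> r1 > 0 \<Longrightarrow> \<phi> 1 x0 = x1"
    and "dist_K \<le> action v 1"
proof -
  obtain \<psi> where v: "L2_unit v" and \<eta>: "L2_unit \<eta>" and w: "\<And>t. t \<in> {0..1} \<Longrightarrow> weight \<eta> t \<ge> 0"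
    and \<psi>: "is_flow ev v \<psi>" and tr: "transported r0 x0 \<eta> \<psi> 1 = dirac r1 x1"
    using a by (auto simp: admissible_def)
  show "L2_unit v" "L2_unit \<eta>" by fact+
  have "dirac ((weight \<eta> 1)\<^sup>2 * r0) (\<psi> 1 x0) = dirac r1 x1"
    using transported_dirac[OF v \<psi>, of 1 r0 x0 \<eta>] tr r0 by simp
  from dirac_eqD[OF this] have e: "(weight \<eta> 1)\<^sup>2 * r0 = r1" "r1 > 0 \<Longrightarrow> \<psi> 1 x0 = x1" using r0 r1 by auto
  have "(weight \<eta> 1)\<^sup>2 = r1 / r0" using e(1) r0 by (simp add: field_simps)
  then have "weight \<eta> 1 = sqrt (r1 / r0)" using w[of 1] by (simp add: real_sqrt_unique)
  then show "integral {0..1} \<eta> = 2 * (sqrt (r1 / r0) - 1)" by (simp add: weight_def field_simps)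
  show "\<phi> 1 x0 = x1" if "is_flow ev v \<phi>" "r1 > 0" for \<phi>
    using flow_unique[OF v that(1) \<psi>, of 1 x0] e(2)[OF that(2)] by simp
  show "dist_K \<le> action v 1"
  proof (cases "r1 > 0")
    case True
    have "reach (action v 1) x0 x1"
      using ctrl_reach[OF flow_ctrl(2)[OF v \<psi>, of x0]] e(2)[OF True] flow_ctrl(1)[OF v \<psi>] by simp
    then show ?thesis by (rule riemannian_dist_reach(2))
  next
    \<comment> \<open>The zero target leaves the endpoint free, but then \<open>x1 = x0\<close> and
      the distance is zero.\<close>
    case False
    then have "dist_K \<le> 0" using r1 x1 riemannian_dist_reach(2)[OF reach_refl[of x0]] by simp
    moreover have "0 \<le> action v 1"
      using action_mono[OF L2_norm_integrable_on[OF v], of 0 1] by (simp add: action_def)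
    ultimately show ?thesis by simp
  qed
qed

lemma weight_cost_identity: "\<gamma> / 2 * r0 * (2 * (sqrt (r1 / r0) - 1))\<^sup>2 = 2 * \<gamma> * (sqrt r1 - sqrt r0)\<^sup>2"
proof -
  have "sqrt r1 - sqrt r0 = sqrt r0 * (sqrt (r1 / r0) - 1)"
    using r0 by (simp add: real_sqrt_divide field_simps)
  then have "(sqrt r1 - sqrt r0)\<^sup>2 = r0 * (sqrt (r1 / r0) - 1)\<^sup>2"
    using r0 by (simp add: power_mult_distrib)
  then show ?thesis unfolding power_mult_distrib by simp
qed

lemma cost_eq:
  "cost \<gamma> r0 (v, \<eta>) = 1 / 2 * (LINT t|lebesgue_on {0..1}. (norm (v t))\<^sup>2) +
     \<gamma> / 2 * r0 * (LINT t|lebesgue_on {0..1}. (\<eta> t)\<^sup>2)"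
  by (simp add: cost_def)

text \<open>Transport and weight terms are bounded separately, so equality of the total forces
  equality in both. The equality case of Cauchy-Schwarz then makes the length of the control and the
  weight affine in time.\<close>

lemma cost_lower_bound:
  assumes a: "(v, \<eta>) \<in> admissible ev r0 x0 (dirac r1 x1)"
  shows "1 / 2 * dist_K\<^sup>2 + 2 * \<gamma> * (sqrt r1 - sqrt r0)\<^sup>2 \<le> cost \<gamma> r0 (v, \<eta>)"
    and "cost \<gamma> r0 (v, \<eta>) \<le> 1 / 2 * dist_K\<^sup>2 + 2 * \<gamma> * (sqrt r1 - sqrt r0)\<^sup>2 \<Longrightarrow> t \<in> {0..1} \<Longrightarrow>
      action v t = dist_K * t \<and> weight \<eta> t = 1 + (sqrt (r1 / r0) - 1) * t"
proof -
  note f = admissible_facts[OF a]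
  note v = L2_unit_integrable[OF f(1)] and \<eta> = L2_real_facts[OF f(2)]
  define I where "I = (LINT t|lebesgue_on {0..1}. (norm (v t))\<^sup>2)"
  define J where "J = (LINT t|lebesgue_on {0..1}. (\<eta> t)\<^sup>2)"
  have 1: "(action v 1)\<^sup>2 \<le> I"
    unfolding action_def I_def by (rule unit_interval_cauchy_schwarz(1)[OF v])
  have 2: "dist_K\<^sup>2 \<le> (action v 1)\<^sup>2" using f(5) dist_K_nonneg by (intro power_mono) auto
  have 3: "(2 * (sqrt (r1 / r0) - 1))\<^sup>2 \<le> J"
    unfolding J_def f(3)[symmetric] by (rule unit_interval_cauchy_schwarz(1)[OF \<eta>])
  have g: "\<gamma> / 2 * r0 > 0" using \<gamma> r0 by simp
  have 4: "2 * \<gamma> * (sqrt r1 - sqrt r0)\<^sup>2 \<le> \<gamma> / 2 * r0 * J"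
    unfolding weight_cost_identity[symmetric] using 3 g by (intro mult_left_mono) auto
  show "1 / 2 * dist_K\<^sup>2 + 2 * \<gamma> * (sqrt r1 - sqrt r0)\<^sup>2 \<le> cost \<gamma> r0 (v, \<eta>)"
    unfolding cost_eq I_def[symmetric] J_def[symmetric] using 1 2 4 by linarith
  assume le: "cost \<gamma> r0 (v, \<eta>) \<le> 1 / 2 * dist_K\<^sup>2 + 2 * \<gamma> * (sqrt r1 - sqrt r0)\<^sup>2" and t: "t \<in> {0..1}"
  then have le': "1 / 2 * I + \<gamma> / 2 * r0 * J \<le> 1 / 2 * dist_K\<^sup>2 + 2 * \<gamma> * (sqrt r1 - sqrt r0)\<^sup>2"
    unfolding cost_eq I_def J_def by blast
  have I: "I \<le> (action v 1)\<^sup>2" and eq: "(action v 1)\<^sup>2 = dist_K\<^sup>2" using le' 1 2 4 by linarith+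
  have "\<gamma> / 2 * r0 * J \<le> \<gamma> / 2 * r0 * (2 * (sqrt (r1 / r0) - 1))\<^sup>2"
    unfolding weight_cost_identity using le' 1 2 by linarith
  then have J: "J \<le> (integral {0..1} \<eta>)\<^sup>2" unfolding f(3) using g by (simp only: mult_le_cancel_left_pos)
  have "action v 1 = dist_K" using eq dist_K_nonneg f(5) by (simp add: power2_eq_iff_nonneg)
  then have "action v t = dist_K * t"
    using unit_interval_cauchy_schwarz(2)[OF v, of t] I t unfolding I_def action_def by simp
  moreover have "integral {0..t} \<eta> = integral {0..1} \<eta> * t"
    using unit_interval_cauchy_schwarz(2)[OF \<eta>, of t] J t unfolding J_def by simp
  then have "weight \<eta> t = 1 + (sqrt (r1 / r0) - 1) * t" unfolding weight_def f(3) by simp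
  ultimately show "action v t = dist_K * t \<and> weight \<eta> t = 1 + (sqrt (r1 / r0) - 1) * t" ..
qed

lemma weight_profile:
  "(1 + (sqrt (r1 / r0) - 1) * t)\<^sup>2 * r0 = ((1 - t) * sqrt r0 + t * sqrt r1)\<^sup>2"
proof -
  have "(1 - t) * sqrt r0 + t * sqrt r1 = (1 + (sqrt (r1 / r0) - 1) * t) * sqrt r0"
    using r0 by (simp add: real_sqrt_divide field_simps)
  then show ?thesis using r0 by (simp add: power_mult_distrib)
qed

text \<open>The velocity lift of a geodesic has constant norm, and \<open>\<eta>\<close> is taken
  constant, so Cauchy-Schwarz is sharp in both terms.\<close>

lemma geodesic_control:
  assumes g: "minimizing_geodesic (kernel_metric K) x0 x1 g"
  obtains v \<eta> \<phi> where "(v, \<eta>) \<in> admissible ev r0 x0 (dirac r1 x1)" "is_flow ev v \<phi>"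
    "cost \<gamma> r0 (v, \<eta>) = 1 / 2 * dist_K\<^sup>2 + 2 * \<gamma> * (sqrt r1 - sqrt r0)\<^sup>2"
    "\<And>t. t \<in> {0..1} \<Longrightarrow> transported r0 x0 \<eta> \<phi> t = dirac (((1 - t) * sqrt r0 + t * sqrt r1)\<^sup>2) (g t)"
proof -
  interpret prob_space "lebesgue_on {0..1::real}" by (rule prob_space_unit_interval)
  have C1: "C1_path g" and ends: "g 0 = x0" "g 1 = x1" and len: "curve_length (kernel_metric K) g = dist_K"
    using g by (auto simp: minimizing_geodesic_def)
  obtain c where c: "\<And>t. t \<in> {0..1} \<Longrightarrow> speed (kernel_metric K) g t = c"
    using g by (auto simp: minimizing_geodesic_def)
  have "curve_length (kernel_metric K) g = c"
    unfolding curve_length_def using c integral_cong[of "{0..1}" "speed (kernel_metric K) g" "\<lambda>_. c"] by simp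
  then have cD: "c = dist_K" using len by simp
  define v where "v = velocity_lift g"
  define e where "e = 2 * (sqrt (r1 / r0) - 1)"
  define \<eta> :: "real \<Rightarrow> real" where "\<eta> = (\<lambda>_. e)"
  have vc: "continuous_on {0..1} v" unfolding v_def by (rule continuous_velocity_lift[OF C1])
  have nv: "norm (v t) = dist_K" if "t \<in> {0..1}" for t
    using c[OF that] cD by (simp add: v_def norm_velocity_lift)
  \<comment> \<open>Continuity gives measurability for the trace of the Borel sets, which is
    contained in the sigma-algebra of \<open>lebesgue_on\<close>.\<close>
  have vm: "v \<in> borel_measurable (lebesgue_on {0..1})"
    using borel_measurable_continuous_on_restrict[OF vc]
    by (rule measurable_mono[OF order_refl _ _ _, THEN subsetD, rotated 3]) (auto simp: sets_restrict_space space_restrict_space)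
  have sp: "space (lebesgue_on {0..1::real}) = {0..1}" by (simp add: space_restrict_space)
  have cg: "integrable (lebesgue_on {0..1}) (\<lambda>t. (norm (v t))\<^sup>2) \<longleftrightarrow> integrable (lebesgue_on {0..1::real}) (\<lambda>t. dist_K\<^sup>2)"
    by (rule Bochner_Integration.integrable_cong[OF refl]) (simp only: sp nv)
  have L2v: "L2_unit v" unfolding L2_unit_def cg using vm by simp
  have Iv: "(LINT t|lebesgue_on {0..1}. (norm (v t))\<^sup>2) = dist_K\<^sup>2"
  proof -
    have "(LINT t|lebesgue_on {0..1}. (norm (v t))\<^sup>2) = (LINT t|lebesgue_on {0..1::real}. dist_K\<^sup>2)"
      by (rule Bochner_Integration.integral_cong[OF refl]) (simp only: sp nv)
    then show ?thesis using prob_space by simp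
  qed
  have L2e: "L2_unit \<eta>" unfolding L2_unit_def \<eta>_def by simp
  have "(LINT t|lebesgue_on {0..1}. (\<eta> t)\<^sup>2) = e\<^sup>2" using prob_space by (simp add: \<eta>_def)
  then have cost: "cost \<gamma> r0 (v, \<eta>) = 1 / 2 * dist_K\<^sup>2 + 2 * \<gamma> * (sqrt r1 - sqrt r0)\<^sup>2"
    unfolding cost_eq Iv by (simp only: e_def weight_cost_identity)
  have "\<exists>y. \<forall>t\<in>{0..1}. ((\<lambda>s. ev (v s) (y s)) has_integral (y t - x)) {0..t}" for x
    by (rule flow_exists[OF vc])
  then have "\<forall>x. \<exists>y. \<forall>t\<in>{0..1}. ((\<lambda>s. ev (v s) (y s)) has_integral (y t - x)) {0..t}" ..
  from choice[OF this] obtain Y where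
    Y: "\<forall>x. \<forall>t\<in>{0..1}. ((\<lambda>s. ev (v s) (Y x s)) has_integral (Y x t - x)) {0..t}" ..
  \<comment> \<open>The flow starting at \<open>x0\<close> is the geodesic itself and elsewhere any
    Picard solution; the flow equation is pointwise in the starting point, so this gluing is
    legitimate.\<close>
  define \<phi> where "\<phi> t x = (if x = x0 then g t else Y x t)" for t x
  have ctg: "ctrl v g" unfolding v_def by (rule ctrl_velocity_lift[OF C1])
  have flow: "is_flow ev v \<phi>"
    unfolding is_flow_def
  proof (intro allI ballI)
    fix x and t :: real assume t: "t \<in> {0..1}"
    show "((\<lambda>s. ev (v s) (\<phi> s x)) has_integral (\<phi> t x - x)) {0..t}"
    proof (cases "x = x0")
      case True
      then show ?thesis using ctg t ends(1) by (simp add: \<phi>_def ctrl_def)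
    next
      case False
      then show ?thesis using Y t by (simp add: \<phi>_def)
    qed
  qed
  have w: "weight \<eta> t = 1 + (sqrt (r1 / r0) - 1) * t" if "t \<in> {0..1}" for t
    using that by (simp add: weight_def \<eta>_def e_def)
  have tr: "transported r0 x0 \<eta> \<phi> t = dirac (((1 - t) * sqrt r0 + t * sqrt r1)\<^sup>2) (g t)" if "t \<in> {0..1}" for t
    using transported_dirac[OF L2v flow that, of r0 x0 \<eta>] r0 w[OF that] weight_profile[of t] by (simp add: \<phi>_def)
  have "weight \<eta> t \<ge> 0" if "t \<in> {0..1}" for t
  proof -
    \<comment> \<open>The weight is a convex combination of 1 and
      \<open>sqrt (r1 / r0)\<close>.\<close>
    have "1 + (sqrt (r1 / r0) - 1) * t = (1 - t) + sqrt (r1 / r0) * t" by (simp add: algebra_simps)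
    moreover have "0 \<le> (1 - t) + sqrt (r1 / r0) * t" using that r0 r1 by simp
    ultimately show ?thesis unfolding w[OF that] by (simp only:)
  qed
  moreover have "transported r0 x0 \<eta> \<phi> 1 = dirac r1 x1" using tr[of 1] ends(2) r1 by simp
  ultimately have "(v, \<eta>) \<in> admissible ev r0 x0 (dirac r1 x1)"
    using L2v L2e flow unfolding admissible_def by blast
  from that[OF this flow cost tr] show ?thesis .
qed

lemma dist_sq_eq:
  "lddmm_fr_dist_sq ev \<gamma> r0 x0 (dirac r1 x1) = ereal (1 / 2 * dist_K\<^sup>2 + 2 * \<gamma> * (sqrt r1 - sqrt r0)\<^sup>2)"
proof -
  obtain g where "minimizing_geodesic (kernel_metric K) x0 x1 g" using riemannian_dist_reach(3) by blast
  then obtain v \<eta> \<phi> where a: "(v, \<eta>) \<in> admissible ev r0 x0 (dirac r1 x1)"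
    "cost \<gamma> r0 (v, \<eta>) = 1 / 2 * dist_K\<^sup>2 + 2 * \<gamma> * (sqrt r1 - sqrt r0)\<^sup>2"
    using geodesic_control by metis
  show ?thesis
    unfolding lddmm_fr_dist_sq_def
  proof (rule antisym)
    show "(INF c\<in>admissible ev r0 x0 (dirac r1 x1). ereal (cost \<gamma> r0 c)) \<le> ereal (1 / 2 * dist_K\<^sup>2 + 2 * \<gamma> * (sqrt r1 - sqrt r0)\<^sup>2)"
      using INF_lower[OF a(1), of "\<lambda>c. ereal (cost \<gamma> r0 c)"] unfolding a(2) .
    show "ereal (1 / 2 * dist_K\<^sup>2 + 2 * \<gamma> * (sqrt r1 - sqrt r0)\<^sup>2) \<le> (INF c\<in>admissible ev r0 x0 (dirac r1 x1). ereal (cost \<gamma> r0 c))"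
      using cost_lower_bound(1) by (intro INF_greatest) auto
  qed
qed

text \<open>For a minimizer the length of the control is linear in time, so the trajectory of
  \<open>x0\<close> satisfies the increment bounds of \<open>minimal_path_C1\<close> with duration
  \<open>dist_K\<close>. The converse is \<open>geodesic_control\<close>.\<close>

lemma geodesic_iff:
  "lddmm_fr_geodesic ev \<gamma> r0 x0 (dirac r1 x1) \<mu> \<longleftrightarrow>
    (\<exists>x. minimizing_geodesic (kernel_metric K) x0 x1 x \<and>
      (\<forall>t\<in>{0..1}. \<mu> t = dirac (((1 - t) * sqrt r0 + t * sqrt r1)\<^sup>2) (x t)))"
proof
  assume "lddmm_fr_geodesic ev \<gamma> r0 x0 (dirac r1 x1) \<mu>"
  then obtain v \<eta> \<phi> where a: "(v, \<eta>) \<in> admissible ev r0 x0 (dirac r1 x1)"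
    and cost: "cost \<gamma> r0 (v, \<eta>) = 1 / 2 * dist_K\<^sup>2 + 2 * \<gamma> * (sqrt r1 - sqrt r0)\<^sup>2"
    and \<phi>: "is_flow ev v \<phi>" and \<mu>: "\<And>t. t \<in> {0..1} \<Longrightarrow> \<mu> t = transported r0 x0 \<eta> \<phi> t"
    unfolding lddmm_fr_geodesic_def dist_sq_eq by auto
  note f = admissible_facts[OF a]
  define x where "x t = \<phi> t x0" for t
  have c: "ctrl v x" unfolding x_def by (rule flow_ctrl(2)[OF f(1) \<phi>])
  have x0': "x 0 = x0" unfolding x_def by (rule flow_ctrl(1)[OF f(1) \<phi>])
  have eq: "action v t = dist_K * t" "weight \<eta> t = 1 + (sqrt (r1 / r0) - 1) * t" if "t \<in> {0..1}" for t
    using cost_lower_bound(2)[OF a _ that] cost by auto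
  \<comment> \<open>For a zero target the measure does not reveal the endpoint; instead the optimal
    control has zero length, so the trajectory stays at \<open>x0\<close>.\<close>
  have x1': "x 1 = x1"
  proof (cases "r1 > 0")
    case True then show ?thesis using f(4)[OF \<phi>] by (simp add: x_def)
  next
    case False
    then have "x1 = x0" using r1 x1 by simp
    then have "dist_K = 0" using riemannian_dist_reach(2)[OF reach_refl[of x0]] dist_K_nonneg by simp
    then have "norm (x 1 - x 0) \<le> 0" using ctrl_norm[OF c, of 0 1] eq(1)[of 1] eq(1)[of 0] by simp
    then show ?thesis using x0' \<open>x1 = x0\<close> by simp
  qed
  have d: "action v t - action v s = dist_K * (t - s)" if "0 \<le> s" "s \<le> t" "t \<le> 1" for s t
    using eq(1)[of s] eq(1)[of t] that by (simp add: right_diff_distrib)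
  have sp: "C1_path x \<and> (\<forall>t\<in>{0..1}. speed (kernel_metric K) x t = dist_K)"
  proof (rule minimal_path_C1[OF dist_K_nonneg])
    show "norm (x t - x s) \<le> C * (dist_K * (t - s))" if "0 \<le> s" "s \<le> t" "t \<le> 1" for s t
      using ctrl_norm[OF c that] by (simp only: d[OF that])
    show "inner b (x t - x s) \<le> (dist_K * (t - s)) * (norm (k (x s) b) + C\<^sup>2 * (dist_K * (t - s)) * norm b)"
      if "0 \<le> s" "s \<le> t" "t \<le> 1" for s t b
      using ctrl_inner[OF c that, of b] by (simp only: d[OF that])
    show "dist_K \<le> S" if "reach S (x 0) (x 1)" for S
      using that riemannian_dist_reach(2) x0' x1' by simp
  qed
  have "curve_length (kernel_metric K) x = dist_K"
    unfolding curve_length_def using sp integral_cong[of "{0..1}" "speed (kernel_metric K) x" "\<lambda>_. dist_K"] by simp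
  then have "minimizing_geodesic (kernel_metric K) x0 x1 x"
    using sp x0' x1' unfolding minimizing_geodesic_def by blast
  moreover have "\<mu> t = dirac (((1 - t) * sqrt r0 + t * sqrt r1)\<^sup>2) (x t)" if "t \<in> {0..1}" for t
    unfolding \<mu>[OF that] transported_dirac[OF f(1) \<phi> that less_imp_le[OF r0]] eq(2)[OF that] weight_profile x_def ..
  ultimately show "\<exists>x. minimizing_geodesic (kernel_metric K) x0 x1 x \<and>
      (\<forall>t\<in>{0..1}. \<mu> t = dirac (((1 - t) * sqrt r0 + t * sqrt r1)\<^sup>2) (x t))" by blast
next
  assume "\<exists>x. minimizing_geodesic (kernel_metric K) x0 x1 x \<and>
      (\<forall>t\<in>{0..1}. \<mu> t = dirac (((1 - t) * sqrt r0 + t * sqrt r1)\<^sup>2) (x t))"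
  then obtain x where x: "minimizing_geodesic (kernel_metric K) x0 x1 x"
    and \<mu>: "\<And>t. t \<in> {0..1} \<Longrightarrow> \<mu> t = dirac (((1 - t) * sqrt r0 + t * sqrt r1)\<^sup>2) (x t)" by blast
  obtain v \<eta> \<phi> where a: "(v, \<eta>) \<in> admissible ev r0 x0 (dirac r1 x1)" "is_flow ev v \<phi>"
    "cost \<gamma> r0 (v, \<eta>) = 1 / 2 * dist_K\<^sup>2 + 2 * \<gamma> * (sqrt r1 - sqrt r0)\<^sup>2"
    "\<And>t. t \<in> {0..1} \<Longrightarrow> transported r0 x0 \<eta> \<phi> t = dirac (((1 - t) * sqrt r0 + t * sqrt r1)\<^sup>2) (x t)"
    using geodesic_control[OF x] by blast
  show "lddmm_fr_geodesic ev \<gamma> r0 x0 (dirac r1 x1) \<mu>"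
    unfolding lddmm_fr_geodesic_def dist_sq_eq
  proof (intro exI conjI ballI)
    show "(v, \<eta>) \<in> admissible ev r0 x0 (dirac r1 x1)" "is_flow ev v \<phi>" by fact+
    show "ereal (cost \<gamma> r0 (v, \<eta>)) = ereal (1 / 2 * dist_K\<^sup>2 + 2 * \<gamma> * (sqrt r1 - sqrt r0)\<^sup>2)" using a(3) by simp
    show "\<mu> t = transported r0 x0 \<eta> \<phi> t" if "t \<in> {0..1}" for t using \<mu>[OF that] a(4)[OF that] by simp
  qed
qed

end

end

theorem proposition2:
  fixes ev :: "'v::{real_inner,complete_space} \<Rightarrow> real^'n \<Rightarrow> real^'n"
    and K :: "real^'n \<Rightarrow> real^'n \<Rightarrow> real^'n^'n"
    and x0 x1 :: "real^'n" and \<gamma> r0 r1 :: real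
  assumes "CARD('n) \<ge> 2"
    and "C2_embedded ev"
    and "reproducing_kernel ev K"
    and "\<And>x. invertible (K x x)"
    and "\<gamma> > 0"
    and "r0 > 0"
    and "r1 \<ge> 0"
    and "r1 = 0 \<Longrightarrow> x1 = x0"
  shows "lddmm_fr_dist_sq ev \<gamma> r0 x0 (dirac r1 x1) =
           ereal (1/2 * (riemannian_dist (kernel_metric K) x0 x1)\<^sup>2
                  + 2 * \<gamma> * (sqrt r1 - sqrt r0)\<^sup>2) \<and>
         (\<exists>\<mu>. lddmm_fr_geodesic ev \<gamma> r0 x0 (dirac r1 x1) \<mu>) \<and>
         (\<forall>\<mu>. lddmm_fr_geodesic ev \<gamma> r0 x0 (dirac r1 x1) \<mu> \<longleftrightarrow>
           (\<exists>x. minimizing_geodesic (kernel_metric K) x0 x1 x \<and>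
              (\<forall>t\<in>{0..1}. \<mu> t = dirac (((1 - t) * sqrt r0 + t * sqrt r1)\<^sup>2) (x t))))"
proof -
  obtain k C where "rkhs_fields ev K k C" using rkhs_fields_exist[OF assms(2-4)] by blast
  then interpret rkhs_fields ev K k C .
  note d = dist_sq_eq[OF assms(5-8)] and g = geodesic_iff[OF assms(5-8)]
  obtain x where "minimizing_geodesic (kernel_metric K) x0 x1 x" using riemannian_dist_reach(3) by blast
  then have "lddmm_fr_geodesic ev \<gamma> r0 x0 (dirac r1 x1) (\<lambda>t. dirac (((1 - t) * sqrt r0 + t * sqrt r1)\<^sup>2) (x t))"
    by (intro g[THEN iffD2] exI conjI) auto
  then show ?thesis using d g by blast
qed

end
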